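(* In the setting of the context (metric space $(\Omega,d)$, positive definite kernel $k$ on $\Omega$ with RKHS $H_k$ and feature map $\Phi(\omega)=k(\cdot,\omega)$, fixed $x\in\mathbb{R}$ with $f(x)>0$), assume: (K0) $K$ is a probability density function symmetric around zero and, with $K_{ij}=\int_{\mathbb{R}}K^i(u)u^j\,du$, the quantities $|K_{14}|,|K_{44}|,|K_{26}|$ are finite; (L1) the marginal density $f$ of $X$ and the conditional densities $g_y$ of $X\mid Y=y$ exist and are twice continuously differentiable, the latter for all $y\in\Omega$, with $\sup_{x,y}|g_y''(x)|<\infty$; moreover for any open $U\subset\Omega$, $\int_U dF_{Y|X}(y|x)$ is continuous as a function of $x$; (S1) $(\Omega,d)$ is compact; (S2) there is $C>0$ with $\|\Phi(\omega_1)-\Phi(\omega_2)\|_{H_k}\le C\,d(\omega_1,\omega_2)$ for all $\omega_1,\omega_2\in\Omega$; (S3) there is $M>0$ with $\|\Phi(\omega)\|_{H_k}=k(\omega,\omega)^{1/2}<M$ for all $\omega\in\Omega$; (S4) $m_\oplus(x)$ exists and is unique, and for any $\epsilon>0$, $$\inf_{\|g-\Phi(m_\oplus(x))\|_{H_k}>\epsilon}\left\{M_\oplus^{H_k}(g,x)-M_\oplus^{H_k}(\Phi(m_\oplus(x)),x)\right\}>0,$$ $$\liminf_n\inf_{\|g-\tilde l_\oplus^{H_k}(x)\|_{H_k}>\epsilon}\left\{\tilde L_n^{H_k}(g)-\tilde L_n^{H_k}(\tilde l_\oplus^{H_k}(x))\right\}>0$$ (infima over $g\in H_k$); (S5) for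 all $n$, $\tilde l_\oplus^k(x)$ and $\hat l_\oplus^k(x)$ exist and are unique, the latter almost surely, and for any $\epsilon>0$, $$\liminf_n\inf_{d(\omega,\tilde l_\oplus^k(x))>\epsilon}\left\{\tilde L_n^k(\omega)-\tilde L_n^k(\tilde l_\oplus^k(x))\right\}>0 .$$ If $h=h_n\to0$ and $nh^4\to\infty$, then $$d\left(m_\oplus(x),\hat l_\oplus^k(x)\right)=o_P(1).$$
   Context: $(\Omega,d)$ is a metric space; $(X,Y)\sim F$ takes values in $\mathbb{R}\times\Omega$; $X$ has finite mean and positive finite variance; the conditional distributions $F_{X|Y},F_{Y|X}$ exist; $(X_i,Y_i)$, $i=1,\dots,n$, are i.i.d. copies of $(X,Y)$. The marginal density $f$ of $X$ has unbounded support, and $x$ is a fixed point with $f(x)>0$. The Fréchet regression function is $m_\oplus(x)=\arg\min_{\omega\in\Omega}\mathrm{E}[d^2(Y,\omega)\mid X=x]$. $k:\Omega\times\Omega\to\mathbb{R}$ is a positive definite kernel with RKHS $H_k$, $\Phi(\omega)=k(\cdot,\omega)$, and $\mathrm{E}[k(Y,Y)]<\infty$. The transformed data follow $\Phi(Y)=m_\oplus^{H_k}(X)+\sigma(X)\varepsilon$, where $\varepsilon$ is an $H_k$-valued random element independent of $X$ with $\mathrm{E}[\langle\varepsilon,g\rangle_{H_k}]=0$ for all $g\in H_k$, $\mathrm{E}\|\varepsilon\|_{H_k}^2=1$, and $\sigma^2(x)=\mathrm{E}[\|\Phi(Y)-m_\oplus^{H_k}(X)\|_{H_k}^2\mid X=x]$.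 Standing assumption on $k$: $\arg\min_{g\in H_k}\mathrm{E}[\|\Phi(Y)-g\|_{H_k}^2\mid X=x]=\Phi(m_\oplus(x))$, i.e. $m_\oplus^{H_k}(x)=\Phi(m_\oplus(x))$. Notation: $h=h_n>0$, $K_h(\cdot)=h^{-1}K(\cdot/h)$; $\mu_j=\mathrm{E}[K_h(X-x)(X-x)^j]$ $(j=0,1,2)$, $\sigma_0^2=\mu_0\mu_2-\mu_1^2$, $s(X,x,h)=\sigma_0^{-2}K_h(X-x)\{\mu_2-\mu_1(X-x)\}$; $\hat\mu_j=\frac1n\sum_iK_h(X_i-x)(X_i-x)^j$, $\hat\sigma_0^2=\hat\mu_0\hat\mu_2-\hat\mu_1^2$, $s_{in}(x,h)=\hat\sigma_0^{-2}K_h(X_i-x)[\hat\mu_2-\hat\mu_1(X_i-x)]$ (on the event $\hat\sigma_0^2>0$). $M_\oplus^{H_k}(g,x)=\mathrm{E}[\|\Phi(Y)-g\|_{H_k}^2\mid X=x]$; $\tilde L_n^{H_k}(g)=\mathrm{E}[s(X,x,h)\|\Phi(Y)-g\|_{H_k}^2]$; $\tilde l_\oplus^{H_k}(x)=\arg\min_{g\in H_k}\tilde L_n^{H_k}(g)$; $\tilde L_n^k(\omega)=\|\tilde l_\oplus^{H_k}(x)-\Phi(\omega)\|_{H_k}^2$; $\tilde l_\oplus^k(x)=\arg\min_{\omega\in\Omega}\tilde L_n^k(\omega)$. Estimators: $\hat l_\oplus^{H_k}(x)=n^{-1}\sum_{i=1}^ns_{in}(x,h)\Phi(Y_i)$ and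 $\hat l_\oplus^k(x)=\arg\min_{\omega\in\Omega}\|\hat l_\oplus^{H_k}(x)-\Phi(\omega)\|_{H_k}^2$. *)

theory Defs
  imports "HOL-Probability.Probability"
begin

definition pos_def_kernel :: "('w \<Rightarrow> 'w \<Rightarrow> real) \<Rightarrow> bool" where
  "pos_def_kernel k \<longleftrightarrow>
     (\<forall>u v. k u v = k v u) \<and>
     (\<forall>A c. finite A \<longrightarrow> 0 \<le> (\<Sum>u\<in>A. \<Sum>v\<in>A. c u * c v * k u v))"

text \<open>The RKHS depends on \<open>k\<close>, so it cannot itself be a type. It is presented by a Hilbert
  space type \<open>'h\<close> and an injective linear map \<open>fn_of\<close> sending each element of \<open>'h\<close> to the function on
  \<open>'w\<close> that it stands for. The range of \<open>fn_of\<close>, with the inner product of \<open>'h\<close>, is the RKHS.\<close>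

definition feature :: "('w \<Rightarrow> 'w \<Rightarrow> real) \<Rightarrow> ('h \<Rightarrow> 'w \<Rightarrow> real) \<Rightarrow> 'w \<Rightarrow> 'h" where
  "feature k fn_of v = inv fn_of (\<lambda>u. k u v)"

definition is_rkhs ::
  "('w \<Rightarrow> 'w \<Rightarrow> real) \<Rightarrow> ('h::{real_inner,complete_space} \<Rightarrow> 'w \<Rightarrow> real) \<Rightarrow> bool" where
  "is_rkhs k fn_of \<longleftrightarrow>
     inj fn_of \<and>
     (\<forall>g g' v. fn_of (g + g') v = fn_of g v + fn_of g' v) \<and>
     (\<forall>c g v. fn_of (c *\<^sub>R g) v = c * fn_of g v) \<and>
     (\<forall>v. (\<lambda>u. k u v) \<in> range fn_of) \<and>
     (\<forall>g v. fn_of g v = g \<bullet> feature k fn_of v)"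

definition is_cond_distr ::
  "'a measure \<Rightarrow> ('a \<Rightarrow> 'u::topological_space) \<Rightarrow> ('a \<Rightarrow> 'v::topological_space) \<Rightarrow>
    ('u \<Rightarrow> 'v measure) \<Rightarrow> bool" where
  "is_cond_distr M U V \<kappa> \<longleftrightarrow>
     \<kappa> \<in> borel \<rightarrow>\<^sub>M prob_algebra borel \<and>
     (\<forall>A\<in>sets borel. \<forall>B\<in>sets borel.
        emeasure M {\<omega> \<in> space M. U \<omega> \<in> A \<and> V \<omega> \<in> B} =
        (\<integral>\<^sup>+u\<in>A. emeasure (\<kappa> u) B \<partial>distr M borel U))"

definition twice_cont_diff :: "(real \<Rightarrow> real) \<Rightarrow> bool" where
  "twice_cont_diff g \<longleftrightarrow>
     g differentiable_on UNIV \<and> deriv g differentiable_on UNIV \<and>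
     continuous_on UNIV (deriv (deriv g))"

text \<open>\<open>FYX z\<close> is the conditional distribution of \<open>Y\<close> given \<open>X = z\<close>.\<close>

definition frechet_obj ::
  "(real \<Rightarrow> 'w::metric_space measure) \<Rightarrow> real \<Rightarrow> 'w \<Rightarrow> real" where
  "frechet_obj FYX z w = (\<integral>y. (dist y w)\<^sup>2 \<partial>FYX z)"

definition frechet_reg :: "(real \<Rightarrow> 'w::metric_space measure) \<Rightarrow> real \<Rightarrow> 'w" where
  "frechet_reg FYX z = arg_min (frechet_obj FYX z) (\<lambda>_. True)"

definition M_H ::
  "(real \<Rightarrow> 'w measure) \<Rightarrow> ('w \<Rightarrow> 'h::real_inner) \<Rightarrow> real \<Rightarrow> 'h \<Rightarrow> real" where
  "M_H FYX \<Phi> z g = (\<integral>y. (norm (\<Phi> y - g))\<^sup>2 \<partial>FYX z)"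

definition m_H :: "(real \<Rightarrow> 'w measure) \<Rightarrow> ('w \<Rightarrow> 'h::real_inner) \<Rightarrow> real \<Rightarrow> 'h" where
  "m_H FYX \<Phi> z = arg_min (M_H FYX \<Phi> z) (\<lambda>_. True)"

definition K_scaled :: "(real \<Rightarrow> real) \<Rightarrow> real \<Rightarrow> real \<Rightarrow> real" where
  "K_scaled K h u = K (u / h) / h"

definition pop_mu ::
  "'a measure \<Rightarrow> ('a \<Rightarrow> real) \<Rightarrow> (real \<Rightarrow> real) \<Rightarrow> real \<Rightarrow> real \<Rightarrow> nat \<Rightarrow> real" where
  "pop_mu M X K x h j = (\<integral>\<omega>. K_scaled K h (X \<omega> - x) * (X \<omega> - x) ^ j \<partial>M)"

definition pop_sigma2 ::
  "'a measure \<Rightarrow> ('a \<Rightarrow> real) \<Rightarrow> (real \<Rightarrow> real) \<Rightarrow> real \<Rightarrow> real \<Rightarrow> real" where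
  "pop_sigma2 M X K x h =
     pop_mu M X K x h 0 * pop_mu M X K x h 2 - (pop_mu M X K x h 1)\<^sup>2"

definition pop_s ::
  "'a measure \<Rightarrow> ('a \<Rightarrow> real) \<Rightarrow> (real \<Rightarrow> real) \<Rightarrow> real \<Rightarrow> real \<Rightarrow> real \<Rightarrow> real" where
  "pop_s M X K x h z =
     K_scaled K h (z - x) * (pop_mu M X K x h 2 - pop_mu M X K x h 1 * (z - x))
       / pop_sigma2 M X K x h"

definition Ltilde_H ::
  "'a measure \<Rightarrow> ('a \<Rightarrow> real) \<Rightarrow> ('a \<Rightarrow> 'w) \<Rightarrow> ('w \<Rightarrow> 'h::real_inner) \<Rightarrow> (real \<Rightarrow> real) \<Rightarrow>
    real \<Rightarrow> real \<Rightarrow> 'h \<Rightarrow> real" where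
  "Ltilde_H M X Y \<Phi> K x h g =
     (\<integral>\<omega>. pop_s M X K x h (X \<omega>) * (norm (\<Phi> (Y \<omega>) - g))\<^sup>2 \<partial>M)"

definition ltilde_H ::
  "'a measure \<Rightarrow> ('a \<Rightarrow> real) \<Rightarrow> ('a \<Rightarrow> 'w) \<Rightarrow> ('w \<Rightarrow> 'h::real_inner) \<Rightarrow> (real \<Rightarrow> real) \<Rightarrow>
    real \<Rightarrow> real \<Rightarrow> 'h" where
  "ltilde_H M X Y \<Phi> K x h = arg_min (Ltilde_H M X Y \<Phi> K x h) (\<lambda>_. True)"

definition Ltilde_k ::
  "'a measure \<Rightarrow> ('a \<Rightarrow> real) \<Rightarrow> ('a \<Rightarrow> 'w) \<Rightarrow> ('w \<Rightarrow> 'h::real_inner) \<Rightarrow> (real \<Rightarrow> real) \<Rightarrow>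
    real \<Rightarrow> real \<Rightarrow> 'w \<Rightarrow> real" where
  "Ltilde_k M X Y \<Phi> K x h w = (norm (ltilde_H M X Y \<Phi> K x h - \<Phi> w))\<^sup>2"

definition ltilde_k ::
  "'a measure \<Rightarrow> ('a \<Rightarrow> real) \<Rightarrow> ('a \<Rightarrow> 'w) \<Rightarrow> ('w \<Rightarrow> 'h::real_inner) \<Rightarrow> (real \<Rightarrow> real) \<Rightarrow>
    real \<Rightarrow> real \<Rightarrow> 'w" where
  "ltilde_k M X Y \<Phi> K x h = arg_min (Ltilde_k M X Y \<Phi> K x h) (\<lambda>_. True)"

text \<open>The estimators are functions of a realised sample \<open>(xs i, ys i)\<close>, \<open>i < n\<close>.\<close>

definition emp_mu ::
  "(real \<Rightarrow> real) \<Rightarrow> real \<Rightarrow> real \<Rightarrow> nat \<Rightarrow> (nat \<Rightarrow> real) \<Rightarrow> nat \<Rightarrow> real" where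
  "emp_mu K x h n xs j = (\<Sum>i<n. K_scaled K h (xs i - x) * (xs i - x) ^ j) / real n"

definition emp_sigma2 ::
  "(real \<Rightarrow> real) \<Rightarrow> real \<Rightarrow> real \<Rightarrow> nat \<Rightarrow> (nat \<Rightarrow> real) \<Rightarrow> real" where
  "emp_sigma2 K x h n xs = emp_mu K x h n xs 0 * emp_mu K x h n xs 2 - (emp_mu K x h n xs 1)\<^sup>2"

definition emp_s ::
  "(real \<Rightarrow> real) \<Rightarrow> real \<Rightarrow> real \<Rightarrow> nat \<Rightarrow> (nat \<Rightarrow> real) \<Rightarrow> nat \<Rightarrow> real" where
  "emp_s K x h n xs i =
     K_scaled K h (xs i - x) * (emp_mu K x h n xs 2 - emp_mu K x h n xs 1 * (xs i - x))
       / emp_sigma2 K x h n xs"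

definition lhat_H ::
  "('w \<Rightarrow> 'h::real_inner) \<Rightarrow> (real \<Rightarrow> real) \<Rightarrow> real \<Rightarrow> real \<Rightarrow> nat \<Rightarrow>
    (nat \<Rightarrow> real) \<Rightarrow> (nat \<Rightarrow> 'w) \<Rightarrow> 'h" where
  "lhat_H \<Phi> K x h n xs ys = (1 / real n) *\<^sub>R (\<Sum>i<n. emp_s K x h n xs i *\<^sub>R \<Phi> (ys i))"

definition Lhat_k ::
  "('w \<Rightarrow> 'h::real_inner) \<Rightarrow> (real \<Rightarrow> real) \<Rightarrow> real \<Rightarrow> real \<Rightarrow> nat \<Rightarrow>
    (nat \<Rightarrow> real) \<Rightarrow> (nat \<Rightarrow> 'w) \<Rightarrow> 'w \<Rightarrow> real" where
  "Lhat_k \<Phi> K x h n xs ys w = (norm (lhat_H \<Phi> K x h n xs ys - \<Phi> w))\<^sup>2"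

definition lhat_k ::
  "('w \<Rightarrow> 'h::real_inner) \<Rightarrow> (real \<Rightarrow> real) \<Rightarrow> real \<Rightarrow> real \<Rightarrow> nat \<Rightarrow>
    (nat \<Rightarrow> real) \<Rightarrow> (nat \<Rightarrow> 'w) \<Rightarrow> 'w" where
  "lhat_k \<Phi> K x h n xs ys = arg_min (Lhat_k \<Phi> K x h n xs ys) (\<lambda>_. True)"

text \<open>Outer probability, because a minimiser chosen by \<open>arg_min\<close> need not depend measurably on
  the sample, and \<open>measure\<close> is \<open>0\<close> on non-measurable sets. For measurable \<open>Z n\<close> this is ordinary
  convergence in probability to \<open>0\<close>.\<close>

definition is_oP1 :: "'a measure \<Rightarrow> (nat \<Rightarrow> 'a \<Rightarrow> real) \<Rightarrow> bool" where
  "is_oP1 M Z \<longleftrightarrow>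
     (\<forall>e>0. (\<lambda>n. outer_measure_of M {\<omega> \<in> space M. e < \<bar>Z n \<omega>\<bar>}) \<longlonglongrightarrow> 0)"

end

theory Submission
  imports Defs
begin

text \<open>Convergence in probability is convergence along \<open>prob_filter M\<close>, so that the local linear weights of
  the population and those of the sample are treated by one limit lemma: the former along
  \<open>sequentially\<close>, the latter, with the uniform measure on the sample, along \<open>prob_filter M\<close>. The weights
  are rational functions of finitely many kernel moments, and the moments converge by dominated convergence,
  respectively by a law of large numbers in mean. Since \<open>\<Phi>\<close> has compact range, it is uniformly
  approximated by step functions; hence the weighted means of \<open>\<Phi> (Y)\<close> converge to the mean \<open>\<theta>\<close> of \<open>\<Phi>\<close>
  under \<open>FYX x\<close>. A quadratic objective that is bounded away from its value at a point outside every ball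
  must have its linear part close to that point; so (S4) gives \<open>\<theta> = \<Phi> (m x)\<close> for the regression value
  \<open>m x\<close> and \<open>ltilde_H \<longlonglongrightarrow> \<theta>\<close>, without knowing that the minimisers exist. Finally \<open>ltilde_H \<longlonglongrightarrow> \<theta>\<close>
  turns (S5) into the statement that \<open>w\<close> is close to \<open>m x\<close> as soon as \<open>\<Phi> w\<close> is close to \<open>\<theta>\<close>.\<close>

section \<open>Convergence in probability as a filter on pairs of sample size and sample
  point\<close>

definition prob_filter :: "'a measure \<Rightarrow> (nat \<times> 'a) filter" where
  "prob_filter M = Abs_filter (\<lambda>P.
     (\<lambda>n. outer_measure_of M {\<omega> \<in> space M. \<not> P (n, \<omega>)}) \<longlonglongrightarrow> 0)"

lemma ennreal_tendsto_0_le: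
  fixes a b :: "nat \<Rightarrow> ennreal"
  assumes "b \<longlonglongrightarrow> 0" "\<And>n. a n \<le> b n"
  shows "a \<longlonglongrightarrow> 0"
  by (rule tendsto_sandwich[OF _ _ tendsto_const assms(1)]) (use assms(2) in auto)

text \<open>Measurable hulls with the same outer measure reduce this to subadditivity of the measure
  itself.\<close>

lemma outer_measure_of_Un_le:
  assumes "A \<subseteq> space M" "B \<subseteq> space M"
  shows "outer_measure_of M (A \<union> B) \<le> outer_measure_of M A + outer_measure_of M B"
proof -
  obtain A' where A': "A' \<in> sets M" "A \<subseteq> A'" "outer_measure_of M A = emeasure M A'"
    using outer_measure_of_attain[OF assms(1)] by auto
  obtain B' where B': "B' \<in> sets M" "B \<subseteq> B'" "outer_measure_of M B = emeasure M B'"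
    using outer_measure_of_attain[OF assms(2)] by auto
  have "outer_measure_of M (A \<union> B) \<le> outer_measure_of M (A' \<union> B')"
    using A' B' by (intro outer_measure_of_mono) auto
  also have "\<dots> = emeasure M (A' \<union> B')" using A' B' by simp
  also have "\<dots> \<le> emeasure M A' + emeasure M B'" using A' B' by (intro emeasure_subadditive)
  finally show ?thesis using A' B' by simp
qed

text \<open>\<open>Abs_filter\<close> is meaningful here because exceptional sets of vanishing outer
  probability are closed under finite unions and subsets. Outer measure admits every predicate,
  measurable or not, in particular those about chosen minimisers.\<close>

lemma eventually_prob_filter:
  "eventually P (prob_filter M) \<longleftrightarrow>
     (\<lambda>n. outer_measure_of M {\<omega> \<in> space M. \<not> P (n, \<omega>)}) \<longlonglongrightarrow> 0"
  unfolding prob_filter_def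
proof (rule eventually_Abs_filter, rule is_filter.intro)
  have "outer_measure_of M {} = 0" by simp
  then show "(\<lambda>n. outer_measure_of M {\<omega> \<in> space M. \<not> True}) \<longlonglongrightarrow> 0" by simp
next
  fix P Q :: "nat \<times> 'a \<Rightarrow> bool"
  assume P: "(\<lambda>n. outer_measure_of M {\<omega> \<in> space M. \<not> P (n, \<omega>)}) \<longlonglongrightarrow> 0"
     and Q: "(\<lambda>n. outer_measure_of M {\<omega> \<in> space M. \<not> Q (n, \<omega>)}) \<longlonglongrightarrow> 0"
  have "outer_measure_of M {\<omega> \<in> space M. \<not> (P (n, \<omega>) \<and> Q (n, \<omega>))}
      \<le> outer_measure_of M {\<omega> \<in> space M. \<not> P (n, \<omega>)} + outer_measure_of M {\<omega> \<in> space M. \<not> Q (n, \<omega>)}" for n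
    by (rule order_trans[OF outer_measure_of_mono outer_measure_of_Un_le]) auto
  then show "(\<lambda>n. outer_measure_of M {\<omega> \<in> space M. \<not> (P (n, \<omega>) \<and> Q (n, \<omega>))}) \<longlonglongrightarrow> 0"
    by (rule ennreal_tendsto_0_le[rotated]) (use tendsto_add[OF P Q] in simp)
next
  fix P Q :: "nat \<times> 'a \<Rightarrow> bool"
  assume PQ: "\<forall>z. P z \<longrightarrow> Q z"
    and P: "(\<lambda>n. outer_measure_of M {\<omega> \<in> space M. \<not> P (n, \<omega>)}) \<longlonglongrightarrow> 0"
  show "(\<lambda>n. outer_measure_of M {\<omega> \<in> space M. \<not> Q (n, \<omega>)}) \<longlonglongrightarrow> 0"
    using PQ by (intro ennreal_tendsto_0_le[OF P] outer_measure_of_mono) auto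
qed

text \<open>Both sides differ only in strictness: \<open>is_oP1\<close> leaves
  \<open>\<bar>Z n \<omega>\<bar> \<le> e\<close> off the exceptional set, while
  \<open>tendsto_iff\<close> asks for a distance strictly below \<open>e\<close>. Passing to
  \<open>e / 2\<close> bridges the gap.\<close>

lemma is_oP1_iff: "is_oP1 M Z \<longleftrightarrow> ((\<lambda>(n, \<omega>). Z n \<omega>) \<longlongrightarrow> 0) (prob_filter M)"
proof -
  have "((\<lambda>(n, \<omega>). Z n \<omega>) \<longlongrightarrow> 0) (prob_filter M)
      \<longleftrightarrow> (\<forall>e>0. \<forall>\<^sub>F (n, \<omega>) in prob_filter M. \<bar>Z n \<omega>\<bar> \<le> e)"
    unfolding tendsto_iff
  proof (intro iffI allI impI)
    fix e :: real assume "\<forall>e>0. \<forall>\<^sub>F z in prob_filter M. dist (case z of (n, \<omega>) \<Rightarrow> Z n \<omega>) 0 < e" "e > 0"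
    then have "\<forall>\<^sub>F z in prob_filter M. dist (case z of (n, \<omega>) \<Rightarrow> Z n \<omega>) 0 < e" by blast
    then show "\<forall>\<^sub>F (n, \<omega>) in prob_filter M. \<bar>Z n \<omega>\<bar> \<le> e"
      by (rule eventually_mono) auto
  next
    fix e :: real assume "\<forall>e>0. \<forall>\<^sub>F (n, \<omega>) in prob_filter M. \<bar>Z n \<omega>\<bar> \<le> e" "e > 0"
    then have "\<forall>\<^sub>F (n, \<omega>) in prob_filter M. \<bar>Z n \<omega>\<bar> \<le> e / 2" using half_gt_zero by blast
    then show "\<forall>\<^sub>F z in prob_filter M. dist (case z of (n, \<omega>) \<Rightarrow> Z n \<omega>) 0 < e"
      by (rule eventually_mono) (use \<open>e > 0\<close> in auto)
  qed
  also have "\<dots> \<longleftrightarrow> is_oP1 M Z"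
    by (simp add: is_oP1_def eventually_prob_filter not_le)
  finally show ?thesis by simp
qed

text \<open>Markov's inequality bounds the probability of a deviation beyond \<open>e\<close> by the
  mean absolute deviation divided by \<open>e\<close>.\<close>

lemma tendsto_prob_filter_L1:
  fixes Z :: "nat \<Rightarrow> 'a \<Rightarrow> real"
  assumes int: "\<And>n. integrable M (Z n)"
    and L1: "(\<lambda>n. \<integral>\<omega>. \<bar>Z n \<omega> - L\<bar> \<partial>M) \<longlonglongrightarrow> 0" and M: "prob_space M"
  shows "((\<lambda>(n, \<omega>). Z n \<omega>) \<longlongrightarrow> L) (prob_filter M)"
proof (rule LIM_zero_cancel)
  interpret prob_space M by fact
  have "is_oP1 M (\<lambda>n \<omega>. Z n \<omega> - L)"
    unfolding is_oP1_def
  proof (intro allI impI)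
    fix e :: real assume e: "e > 0"
    have [measurable]: "Z n \<in> borel_measurable M" for n using int[of n] by simp
    have le: "outer_measure_of M {\<omega> \<in> space M. e < \<bar>Z n \<omega> - L\<bar>} \<le> ennreal (1 / e * (\<integral>\<omega>. \<bar>Z n \<omega> - L\<bar> \<partial>M))" for n
    proof -
      have "outer_measure_of M {\<omega> \<in> space M. e < \<bar>Z n \<omega> - L\<bar>} \<le> outer_measure_of M {\<omega> \<in> space M. e \<le> \<bar>Z n \<omega> - L\<bar>}"
        by (intro outer_measure_of_mono) auto
      also have "\<dots> = emeasure M {\<omega> \<in> space M. e \<le> \<bar>Z n \<omega> - L\<bar>}"
        by (intro outer_measure_of_eq) measurable
      also have "\<dots> \<le> ennreal (1 / e * (\<integral>\<omega>. \<bar>Z n \<omega> - L\<bar> \<partial>M))"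
        using e int by (intro integral_Markov_inequality integrable_abs Bochner_Integration.integrable_diff) auto
      finally show ?thesis .
    qed
    have "(\<lambda>n. ennreal (1 / e * (\<integral>\<omega>. \<bar>Z n \<omega> - L\<bar> \<partial>M))) \<longlonglongrightarrow> ennreal (1 / e * 0)"
      by (intro tendsto_ennrealI tendsto_mult L1 tendsto_const)
    then have lim: "(\<lambda>n. ennreal (1 / e * (\<integral>\<omega>. \<bar>Z n \<omega> - L\<bar> \<partial>M))) \<longlonglongrightarrow> 0" by simp
    show "(\<lambda>n. outer_measure_of M {\<omega> \<in> space M. e < \<bar>Z n \<omega> - L\<bar>}) \<longlonglongrightarrow> 0"
      by (rule ennreal_tendsto_0_le[OF lim le])
  qed
  then show "((\<lambda>z. (case z of (n, \<omega>) \<Rightarrow> Z n \<omega>) - L) \<longlongrightarrow> 0) (prob_filter M)"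
    unfolding is_oP1_iff by (simp add: case_prod_unfold)
qed

text \<open>In the applications \<open>(norm v)\<^sup>2 - 2 * r v\<close> is the increase of a
  quadratic objective when its argument moves by \<open>v\<close>. If it is nonnegative outside a
  ball, then \<open>r\<close> is small on the unit sphere; by homogeneity it suffices to test one
  length in each direction.\<close>

lemma linear_part_le:
  fixes r :: "'h::real_normed_vector \<Rightarrow> real"
  assumes e: "e > 0" and lin: "\<And>c v. r (c *\<^sub>R v) = c * r v"
    and pos: "\<And>v. norm v > e \<Longrightarrow> (norm v)\<^sup>2 - 2 * r v \<ge> 0"
  shows "\<bar>r v\<bar> \<le> e * norm v"
proof (cases "v = 0")
  case True then show ?thesis using lin[of 0 0] by simp
next
  case False
  have *: "r u \<le> e * norm u" if "u \<noteq> 0" for u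
  proof -
    \<comment> \<open>The length \<open>2 * e\<close> exceeds \<open>e\<close>, so
      \<open>pos\<close> applies; a test vector of length \<open>t\<close> yields
      \<open>r u / norm u \<le> t / 2\<close>, which for \<open>t = 2 * e\<close> is the bound
      \<open>e\<close>.\<close>
    have "norm ((2 * e / norm u) *\<^sub>R u) = 2 * e" using that e by simp
    with pos[of "(2 * e / norm u) *\<^sub>R u"] e
    have "0 \<le> (2 * e)\<^sup>2 - 2 * ((2 * e / norm u) * r u)" by (simp add: lin)
    then have "(4 * e) * (r u / norm u) \<le> (4 * e) * e" by (simp add: power2_eq_square)
    then have "r u / norm u \<le> e" by (rule mult_left_le_imp_le) (use e in simp)
    then show ?thesis using that by (simp add: field_simps)
  qed
  have "r (- v) = - r v" using lin[of "-1" v] by simp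
  with *[OF False] *[of "-v"] False show ?thesis by (simp add: abs_le_iff)
qed

text \<open>Testing with \<open>v = u\<close> suffices. Means of features are handled through real
  integrals of inner products, and this lemma leads back to the norm.\<close>

lemma norm_le_of_inner_le:
  fixes u :: "'h::real_inner"
  assumes "\<And>v. \<bar>u \<bullet> v\<bar> \<le> e * norm v" and "0 \<le> e"
  shows "norm u \<le> e"
proof (cases "u = 0")
  case False
  have "norm u * norm u \<le> e * norm u"
    using assms(1)[of u] by (simp add: power2_norm_eq_inner[symmetric] power2_eq_square)
  with False show ?thesis by simp
qed (use assms in simp)

text \<open>The sets \<open>V l\<close> are the partial unions of a finite cover, so that the differences of indicators
  are the indicators of a partition, while every \<open>V l\<close> is open.\<close>

lemma compact_step_approximation:
  fixes \<Phi> :: "'w::metric_space \<Rightarrow> 'h::real_normed_vector"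
  assumes cont: "continuous_on UNIV \<Phi>" and cpt: "compact (UNIV :: 'w set)" and e: "e > 0"
  obtains m and V :: "nat \<Rightarrow> 'w set" and w where "\<And>l. open (V l)"
    "\<And>y. norm (\<Phi> y - (\<Sum>l<m. (indicator (V (Suc l)) y - indicator (V l) y) *\<^sub>R \<Phi> (w l))) \<le> e"
proof -
  \<comment> \<open>Preimages of balls in feature space: on \<open>U w\<close>, replacing
    \<open>\<Phi> y\<close> by \<open>\<Phi> w\<close> costs less than \<open>e\<close>.\<close>
  define U where "U w = {y. norm (\<Phi> y - \<Phi> w) < e}" for w
  have "open (U w)" for w unfolding U_def
    by (intro open_Collect_less continuous_intros) (use cont in auto)
  moreover have "UNIV \<subseteq> (\<Union>w. U w)" using e by (auto simp: U_def)
  ultimately obtain D where D: "finite D" "UNIV \<subseteq> (\<Union>w\<in>D. U w)"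
    using compactE_image[OF cpt, of UNIV U] by auto
  obtain ws where ws: "set ws = D" using D(1) finite_list by blast
  define m where "m = length ws"
  define V where "V l = (\<Union>j<l. U (ws ! j))" for l
  have mono: "V i \<subseteq> V j" if "i \<le> j" for i j using that unfolding V_def by fastforce
  show ?thesis
  proof (rule that[where m = m and V = V and w = "\<lambda>l. ws ! l"])
    show "open (V l)" for l using \<open>\<And>w. open (U w)\<close> by (auto simp: V_def)
    fix y
    obtain i where "i < m" "y \<in> U (ws ! i)"
      using D(2) ws unfolding m_def by (metis UN_E UNIV_I in_set_conv_nth subsetD)
    then have "y \<in> V m" by (auto simp: V_def)
    \<comment> \<open>The first index at which \<open>y\<close> is covered. Since \<open>V 0\<close>
      is empty it is a successor \<open>Suc c\<close>, and since the \<open>V l\<close> increase,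
      \<open>y\<close> lies in \<open>V l\<close> exactly for \<open>l > c\<close>; hence only the
      summand \<open>c\<close> survives.\<close>
    define L where "L = (LEAST l. y \<in> V l)"
    have L: "y \<in> V L" "L \<le> m" using \<open>y \<in> V m\<close> unfolding L_def by (auto intro: LeastI Least_le)
    have notL: "y \<notin> V l" if "l < L" for l using that unfolding L_def by (rule not_less_Least)
    have "V 0 = {}" by (simp add: V_def)
    with L obtain c where c: "L = Suc c" by (cases L) auto
    have iff: "y \<in> V l \<longleftrightarrow> c < l" for l
      by (cases "c < l") (use notL[of l] L mono[of L l] c in auto)
    have "(\<Sum>l<m. (indicator (V (Suc l)) y - indicator (V l) y) *\<^sub>R \<Phi> (ws ! l))
        = (\<Sum>l<m. if l = c then \<Phi> (ws ! l) else 0)"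
      by (intro sum.cong) (auto simp: indicator_def iff)
    also have "\<dots> = \<Phi> (ws ! c)" using L c by simp
    finally have eq: "(\<Sum>l<m. (indicator (V (Suc l)) y - indicator (V l) y) *\<^sub>R \<Phi> (ws ! l)) = \<Phi> (ws ! c)" .
    have "y \<in> U (ws ! c)" using L(1) notL[of c] c unfolding V_def by (auto simp: less_Suc_eq)
    then show "norm (\<Phi> y - (\<Sum>l<m. (indicator (V (Suc l)) y - indicator (V l) y) *\<^sub>R \<Phi> (ws ! l))) \<le> e"
      unfolding eq U_def by simp
  qed
qed

section \<open>Pointwise bounds for densities with bounded second derivative\<close>

lemma second_derivative_lower_bound:
  fixes g :: "real \<Rightarrow> real"
  assumes diff: "g differentiable_on UNIV" "deriv g differentiable_on UNIV"
    and B: "\<And>z. \<bar>deriv (deriv g) z\<bar> \<le> B"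
  shows "g z + deriv g z * t - B / 2 * t\<^sup>2 \<le> g (z + t)"
proof (cases "t = 0")
  case False
  have d1: "(g has_real_derivative deriv g u) (at u)" for u
    using diff(1) by (auto simp: differentiable_on_def DERIV_deriv_iff_real_differentiable)
  have d2: "(deriv g has_real_derivative deriv (deriv g) u) (at u)" for u
    using diff(2) by (auto simp: differentiable_on_def DERIV_deriv_iff_real_differentiable)
  \<comment> \<open>Taylor's formula of order two with Lagrange remainder. The interval from
    \<open>min\<close> to \<open>max\<close> serves both signs of \<open>t\<close>; equal endpoints
    are excluded by the case distinction.\<close>
  have "\<exists>s. (if z + t < z then z + t < s \<and> s < z else z < s \<and> s < z + t) \<and>
      g (z + t) = (\<Sum>m<2. ((\<lambda>i. (deriv ^^ i) g) m z / fact m) * (z + t - z) ^ m)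
        + ((\<lambda>i. (deriv ^^ i) g) 2 s / fact 2) * (z + t - z) ^ 2"
    using False d1 d2
    by (intro Taylor[of 2 _ g "min z (z + t)" "max z (z + t)"])
      (auto simp: less_2_cases_iff)
  then obtain s where "g (z + t) = g z + deriv g z * t + deriv (deriv g) s / 2 * t\<^sup>2"
    by (auto simp: numeral_2_eq_2)
  moreover have "- (B / 2) * t\<^sup>2 \<le> deriv (deriv g) s / 2 * t\<^sup>2"
    using B[of s] by (intro mult_right_mono) auto
  ultimately show ?thesis by simp
qed simp

text \<open>On the unit interval \<open>I\<close> on that side of \<open>z\<close> where the tangent
  at \<open>z\<close> does not descend, \<open>g\<close> stays above \<open>g z - B / 2\<close>. As
  the total mass is 1, this lower bound is at most 1.\<close>

lemma density_le_of_second_derivative_le: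
  fixes g :: "real \<Rightarrow> real"
  assumes g: "twice_cont_diff g" "\<And>z. 0 \<le> g z" and prob: "prob_space (density lborel (\<lambda>z. ennreal (g z)))"
    and B: "\<And>z. \<bar>deriv (deriv g) z\<bar> \<le> B"
  shows "g z \<le> 1 + B / 2"
proof -
  have diff: "g differentiable_on UNIV" "deriv g differentiable_on UNIV"
    using g by (auto simp: twice_cont_diff_def)
  have [measurable]: "g \<in> borel_measurable borel"
    using diff(1) by (intro borel_measurable_continuous_onI differentiable_imp_continuous_on)
  have B0: "0 \<le> B" using B[of 0] by simp
  define I where "I = (if 0 \<le> deriv g z then {z..z + 1} else {z - 1..z})"
  have low: "g z - B / 2 \<le> g u" if "u \<in> I" for u
  proof -
    have "0 \<le> deriv g z * (u - z)"
      using that by (auto simp: I_def zero_le_mult_iff split: if_splits)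
    moreover have "(u - z)\<^sup>2 \<le> 1"
      using that by (auto simp: I_def abs_square_le_1 abs_le_iff split: if_splits)
    then have "B / 2 * (u - z)\<^sup>2 \<le> B / 2 * 1" using B0 by (intro mult_left_mono) auto
    ultimately show ?thesis
      using second_derivative_lower_bound[OF diff B, of z "u - z"] by simp
  qed
  have "ennreal (g z - B / 2) = (\<integral>\<^sup>+u. ennreal (g z - B / 2) * indicator I u \<partial>lborel)"
    by (subst nn_integral_cmult_indicator) (auto simp: I_def)
  also have "\<dots> \<le> (\<integral>\<^sup>+u. ennreal (g u) \<partial>lborel)"
    by (intro nn_integral_mono) (auto simp: indicator_def intro!: ennreal_leI low)
  also have "\<dots> = emeasure (density lborel (\<lambda>z. ennreal (g z))) (space (density lborel (\<lambda>z. ennreal (g z))))"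
    by (subst emeasure_density) auto
  also have "\<dots> = ennreal 1" using prob_space.emeasure_space_1[OF prob] by simp
  finally show ?thesis by (subst (asm) ennreal_le_iff) auto
qed

section \<open>Kernel smoothing\<close>

text \<open>The change of variables \<open>z = x + h * u\<close> moves the bandwidth from the kernel
  into the argument of \<open>q\<close>.\<close>

lemma kernel_substitution:
  fixes q \<kappa> :: "real \<Rightarrow> real"
  assumes "0 < h"
  shows "(\<integral>z. q z * (\<kappa> ((z - x) / h) / h) \<partial>lborel) = (\<integral>u. q (x + h * u) * \<kappa> u \<partial>lborel)"
proof -
  have "(\<integral>z. q z * (\<kappa> ((z - x) / h) / h) \<partial>lborel) = h * (\<integral>u. (q (x + h * u) * \<kappa> u) / h \<partial>lborel)"
    using assms by (subst lborel_integral_real_affine[of h _ x]) simp_all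
  also have "(\<integral>u. (q (x + h * u) * \<kappa> u) / h \<partial>lborel) = (\<integral>u. q (x + h * u) * \<kappa> u \<partial>lborel) / h"
    by (rule integral_divide_zero)
  finally show ?thesis using assms by simp
qed

lemma kernel_integrable:
  fixes q \<kappa> :: "real \<Rightarrow> real"
  assumes h: "0 < h" and \<kappa>: "integrable lborel \<kappa>" and q[measurable]: "q \<in> borel_measurable borel"
    and G: "\<And>z. \<bar>q z\<bar> \<le> G"
  shows "integrable lborel (\<lambda>z. q z * (\<kappa> ((z - x) / h) / h))"
proof -
  have [measurable]: "\<kappa> \<in> borel_measurable borel" using \<kappa> by simp
  have "integrable lborel (\<lambda>u. q (x + h * u) * \<kappa> u)"
    by (rule Bochner_Integration.integrable_bound[OF integrable_mult_right[OF integrable_norm[OF \<kappa>], of G]])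
      (auto simp: abs_mult intro!: mult_mono G order_trans[OF G abs_ge_self])
  then have "integrable lborel (\<lambda>u. (\<lambda>z. q z * \<kappa> ((z - x) / h)) (x + h * u))" using h by simp
  then have "integrable lborel (\<lambda>z. q z * \<kappa> ((z - x) / h))"
    by (subst (asm) lborel_integrable_real_affine_iff) (use h in auto)
  then have "integrable lborel (\<lambda>z. q z * \<kappa> ((z - x) / h) / h)" by (rule integrable_divide)
  then show ?thesis by (simp add: field_simps)
qed

text \<open>After the substitution, \<open>q (x + h n * u)\<close> tends to \<open>q x\<close> for
  each \<open>u\<close> by continuity at the single point \<open>x\<close>, and
  \<open>G * \<bar>\<kappa> u\<bar>\<close> dominates.\<close>

lemma kernel_smoothing_limit:
  fixes q \<kappa> :: "real \<Rightarrow> real" and h :: "nat \<Rightarrow> real"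
  assumes \<kappa>: "integrable lborel \<kappa>" and q[measurable]: "q \<in> borel_measurable borel"
    and G: "\<And>z. \<bar>q z\<bar> \<le> G" and cont: "isCont q x" and h: "\<And>n. 0 < h n" "h \<longlonglongrightarrow> 0"
  shows "(\<lambda>n. \<integral>z. q z * (\<kappa> ((z - x) / h n) / h n) \<partial>lborel) \<longlonglongrightarrow> q x * (\<integral>u. \<kappa> u \<partial>lborel)"
proof -
  have [measurable]: "\<kappa> \<in> borel_measurable borel" using \<kappa> by simp
  have "(\<lambda>n. \<integral>u. q (x + h n * u) * \<kappa> u \<partial>lborel) \<longlonglongrightarrow> (\<integral>u. q x * \<kappa> u \<partial>lborel)"
  proof (rule integral_dominated_convergence)
    show "integrable lborel (\<lambda>u. G * norm (\<kappa> u))" using \<kappa> by simp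
    show "AE u in lborel. norm (q (x + h n * u) * \<kappa> u) \<le> G * norm (\<kappa> u)" for n
      by (auto simp: abs_mult intro!: mult_right_mono G)
    have "(\<lambda>n. x + h n * u) \<longlonglongrightarrow> x" for u
      using tendsto_add[OF tendsto_const tendsto_mult[OF h(2) tendsto_const]] by fastforce
    then have "(\<lambda>n. q (x + h n * u)) \<longlonglongrightarrow> q x" for u by (rule isCont_tendsto_compose[OF cont])
    then show "AE u in lborel. (\<lambda>n. q (x + h n * u) * \<kappa> u) \<longlonglongrightarrow> q x * \<kappa> u"
      by (intro AE_I2 tendsto_mult tendsto_const)
  qed auto
  then show ?thesis unfolding kernel_substitution[OF h(1)] by simp
qed

section \<open>Integrals by means of the conditional distribution\<close>

lemma prob_space_cond_distr:
  assumes "is_cond_distr M X Y FYX"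
  shows "prob_space (FYX z)" "sets (FYX z) = sets borel"
proof -
  have "FYX \<in> borel \<rightarrow>\<^sub>M prob_algebra borel" using assms by (simp add: is_cond_distr_def)
  then have "FYX z \<in> space (prob_algebra borel)" by (auto dest: measurable_space)
  then show "prob_space (FYX z)" "sets (FYX z) = sets borel" by (auto simp: space_prob_algebra)
qed

lemma borel_measurable_cond_distr:
  assumes "is_cond_distr M X Y FYX" "B \<in> sets borel"
  shows "(\<lambda>z. measure (FYX z) B) \<in> borel_measurable borel"
proof -
  have "FYX \<in> borel \<rightarrow>\<^sub>M prob_algebra borel" using assms by (simp add: is_cond_distr_def)
  then have [measurable]: "FYX \<in> borel \<rightarrow>\<^sub>M subprob_algebra borel" by (rule measurable_prob_algebraD)
  show ?thesis using assms(2) by measurable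
qed

text \<open>Restricting \<open>M\<close> to the event that \<open>Y\<close> lies in \<open>B\<close>
  gives a measure \<open>D\<close> whose image under \<open>X\<close> has density
  \<open>f z * measure (FYX z) B\<close>, by the defining property of the conditional distribution.
  Integrating \<open>\<phi>\<close> against this image gives both sides.\<close>

lemma cond_distr_integral:
  fixes X :: "'a \<Rightarrow> real" and \<phi> :: "real \<Rightarrow> real"
  assumes "prob_space M" and X[measurable]: "X \<in> borel_measurable M" and Y[measurable]: "Y \<in> M \<rightarrow>\<^sub>M borel"
    and FYX: "is_cond_distr M X Y FYX" and f: "distributed M lborel X (\<lambda>z. ennreal (f z))" "\<And>z. 0 \<le> f z"
      "f \<in> borel_measurable borel"
    and \<phi>[measurable]: "\<phi> \<in> borel_measurable borel" and B[measurable]: "B \<in> sets borel"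
  shows "(\<integral>\<omega>. indicator B (Y \<omega>) * \<phi> (X \<omega>) \<partial>M) = (\<integral>z. f z * measure (FYX z) B * \<phi> z \<partial>lborel)"
proof -
  note [measurable] = f(3) borel_measurable_cond_distr[OF FYX B]
  define D where "D = density M (\<lambda>\<omega>. ennreal (indicator B (Y \<omega>)))"
  have eq: "distr D borel X = density lborel (\<lambda>z. ennreal (f z * measure (FYX z) B))"
  proof (rule measure_eqI)
    fix A assume "A \<in> sets (distr D borel X)"
    then have A[measurable]: "A \<in> sets borel" by simp
    have "emeasure (distr D borel X) A = (\<integral>\<^sup>+\<omega>. indicator {\<omega> \<in> space M. X \<omega> \<in> A \<and> Y \<omega> \<in> B} \<omega> \<partial>M)"
      unfolding D_def
    proof (subst emeasure_distr)
      show "emeasure (density M (\<lambda>\<omega>. ennreal (indicator B (Y \<omega>))))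
          (X -` A \<inter> space (density M (\<lambda>\<omega>. ennreal (indicator B (Y \<omega>)))))
        = (\<integral>\<^sup>+\<omega>. indicator {\<omega> \<in> space M. X \<omega> \<in> A \<and> Y \<omega> \<in> B} \<omega> \<partial>M)"
        by (subst emeasure_density) (auto simp del: nn_integral_indicator simp: indicator_def intro!: nn_integral_cong)
    qed auto
    also have "\<dots> = emeasure M {\<omega> \<in> space M. X \<omega> \<in> A \<and> Y \<omega> \<in> B}"
      by (subst nn_integral_indicator) auto
    also have "\<dots> = (\<integral>\<^sup>+u\<in>A. emeasure (FYX u) B \<partial>distr M borel X)"
      using FYX A B by (simp add: is_cond_distr_def)
    also have "distr M borel X = distr M lborel X" by (rule distr_cong) auto
    also have "\<dots> = density lborel (\<lambda>z. ennreal (f z))" using f(1) by (simp add: distributed_def)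
    also have "(\<integral>\<^sup>+u\<in>A. emeasure (FYX u) B \<partial>density lborel (\<lambda>z. ennreal (f z)))
      = (\<integral>\<^sup>+u. ennreal (f u * measure (FYX u) B) * indicator A u \<partial>lborel)"
      using prob_space_cond_distr(1)[OF FYX] f(2)
      by (subst nn_integral_density) (auto simp: finite_measure.emeasure_eq_measure prob_space.finite_measure
         ennreal_mult mult_ac intro!: nn_integral_cong)
    also have "\<dots> = emeasure (density lborel (\<lambda>z. ennreal (f z * measure (FYX z) B))) A"
      by (subst emeasure_density) auto
    finally show "emeasure (distr D borel X) A = \<dots>" .
  qed simp
  have "(\<integral>\<omega>. indicator B (Y \<omega>) * \<phi> (X \<omega>) \<partial>M) = (\<integral>\<omega>. \<phi> (X \<omega>) \<partial>D)"
    unfolding D_def by (subst integral_density) auto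
  also have "\<dots> = (\<integral>z. \<phi> z \<partial>distr D borel X)"
    by (subst integral_distr) (auto simp: D_def)
  also have "\<dots> = (\<integral>z. f z * measure (FYX z) B * \<phi> z \<partial>lborel)"
    unfolding eq by (subst integral_density) (auto simp: f(2))
  finally show ?thesis .
qed

section \<open>A law of large numbers in mean\<close>

lemma (in prob_space) expectation_sum_square_indep:
  fixes W :: "nat \<Rightarrow> 'a \<Rightarrow> real"
  assumes indep: "indep_vars (\<lambda>_. borel) W UNIV"
    and int: "\<And>i. integrable M (\<lambda>\<omega>. (W i \<omega>)\<^sup>2)" and mean: "\<And>i. expectation (W i) = 0"
  shows "integrable M (\<lambda>\<omega>. (\<Sum>i<n. W i \<omega>)\<^sup>2) \<and>
    expectation (\<lambda>\<omega>. (\<Sum>i<n. W i \<omega>)\<^sup>2) = (\<Sum>i<n. expectation (\<lambda>\<omega>. (W i \<omega>)\<^sup>2))"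
proof (induction n)
  case (Suc n)
  have [measurable]: "random_variable borel (W i)" for i using indep by (auto simp: indep_vars_def)
  have iW: "integrable M (W i)" for i by (rule square_integrable_imp_integrable[OF _ int]) simp
  have iS: "integrable M (\<lambda>\<omega>. \<Sum>i<n. W i \<omega>)" using iW by simp
  have ind: "indep_var borel (W n) borel (\<lambda>\<omega>. \<Sum>i<n. W i \<omega>)"
    by (rule indep_vars_sum) (auto intro: indep_vars_subset[OF indep])
  note prod = indep_var_integrable[OF ind iW iS] indep_var_lebesgue_integral[OF ind iW iS]
  \<comment> \<open>The expectation of the cross term factors by independence of \<open>W n\<close>
    from the earlier sum, and vanishes because \<open>W n\<close> is centred.\<close>
  have exp: "(\<Sum>i<Suc n. W i \<omega>)\<^sup>2 = (\<Sum>i<n. W i \<omega>)\<^sup>2 + (W n \<omega>)\<^sup>2 + 2 * (W n \<omega> * (\<Sum>i<n. W i \<omega>))" for \<omega>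
    by (simp add: power2_sum)
  show ?case unfolding exp using Suc prod int mean by simp
qed simp

text \<open>The variance of \<open>\<bar>T\<bar>\<close> is nonnegative.\<close>

lemma (in prob_space) expectation_abs_le_sqrt:
  fixes T :: "'a \<Rightarrow> real"
  assumes [measurable]: "T \<in> borel_measurable M" and int: "integrable M (\<lambda>\<omega>. (T \<omega>)\<^sup>2)"
  shows "expectation (\<lambda>\<omega>. \<bar>T \<omega>\<bar>) \<le> sqrt (expectation (\<lambda>\<omega>. (T \<omega>)\<^sup>2))"
proof (rule real_le_rsqrt)
  have "integrable M T" by (rule square_integrable_imp_integrable[OF _ int]) simp
  then show "(expectation (\<lambda>\<omega>. \<bar>T \<omega>\<bar>))\<^sup>2 \<le> expectation (\<lambda>\<omega>. (T \<omega>)\<^sup>2)"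
    using variance_eq[of "\<lambda>\<omega>. \<bar>T \<omega>\<bar>"] variance_positive[of "\<lambda>\<omega>. \<bar>T \<omega>\<bar>"] int by simp
qed

text \<open>Meant for a function split by truncation: the part \<open>\<phi>1\<close> with a second
  moment is controlled by its variance, which gains a factor \<open>1 / n\<close>, and the remainder
  \<open>\<phi>2\<close> by its mean absolute value, which has to be small by itself.\<close>

lemma (in prob_space) iid_mean_deviation:
  fixes Z :: "nat \<Rightarrow> 'a \<Rightarrow> 'b" and \<phi>1 \<phi>2 :: "'b \<Rightarrow> real"
  assumes indep: "indep_vars (\<lambda>_. N) Z UNIV" and distr: "\<And>i. distr M N (Z i) = D"
    and meas[measurable]: "\<phi>1 \<in> borel_measurable N" "\<phi>2 \<in> borel_measurable N"
    and int: "integrable D (\<lambda>z. (\<phi>1 z)\<^sup>2)" "integrable D \<phi>2" and n: "0 < n"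
  shows "integrable M (\<lambda>\<omega>. (\<Sum>i<n. \<phi>1 (Z i \<omega>) + \<phi>2 (Z i \<omega>)) / n)"
    and "expectation (\<lambda>\<omega>. \<bar>(\<Sum>i<n. \<phi>1 (Z i \<omega>) + \<phi>2 (Z i \<omega>)) / n - (\<integral>z. \<phi>1 z + \<phi>2 z \<partial>D)\<bar>)
      \<le> sqrt ((\<integral>z. (\<phi>1 z)\<^sup>2 \<partial>D) / n) + 2 * (\<integral>z. \<bar>\<phi>2 z\<bar> \<partial>D)"
proof -
  have Z[measurable]: "Z i \<in> M \<rightarrow>\<^sub>M N" for i using indep by (auto simp: indep_vars_def)
  have sD: "sets D = sets N" using distr[of 0] by auto
  interpret D: prob_space D using prob_space_distr[OF Z[of 0]] distr by simp
  note [measurable_cong] = sD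
  have i1: "integrable D \<phi>1" by (rule D.square_integrable_imp_integrable[OF _ int(1)]) simp
  have E: "expectation (\<lambda>\<omega>. \<psi> (Z i \<omega>)) = (\<integral>z. \<psi> z \<partial>D)" if "\<psi> \<in> borel_measurable N" for \<psi> :: "'b \<Rightarrow> real" and i
    using that by (subst distr[symmetric, of i]) (simp add: integral_distr)
  have I: "integrable M (\<lambda>\<omega>. \<psi> (Z i \<omega>))" if "integrable D \<psi>" for \<psi> :: "'b \<Rightarrow> real" and i
    using that distr[of i] by (intro integrable_distr[OF Z]) simp
  show "integrable M (\<lambda>\<omega>. (\<Sum>i<n. \<phi>1 (Z i \<omega>) + \<phi>2 (Z i \<omega>)) / n)"
    using I i1 int(2) by (intro integrable_divide Bochner_Integration.integrable_sum Bochner_Integration.integrable_add) auto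
  define m1 m2 where "m1 = (\<integral>z. \<phi>1 z \<partial>D)" and "m2 = (\<integral>z. \<phi>2 z \<partial>D)"
  define T where "T \<omega> = (\<Sum>i<n. \<phi>1 (Z i \<omega>) - m1)" for \<omega>
  define R where "R \<omega> = (\<Sum>i<n. \<phi>2 (Z i \<omega>) - m2)" for \<omega>
  have sq1: "integrable D (\<lambda>z. (\<phi>1 z - m1)\<^sup>2)"
    unfolding power2_diff using int i1 by simp
  have "(\<integral>z. (\<phi>1 z - m1)\<^sup>2 \<partial>D) = (\<integral>z. (\<phi>1 z)\<^sup>2 \<partial>D) - m1\<^sup>2"
    unfolding m1_def using D.variance_eq[OF i1 int(1)] by simp
  then have var: "(\<integral>z. (\<phi>1 z - m1)\<^sup>2 \<partial>D) \<le> (\<integral>z. (\<phi>1 z)\<^sup>2 \<partial>D)" by simp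
  have indW: "indep_vars (\<lambda>_. borel) (\<lambda>i \<omega>. \<phi>1 (Z i \<omega>) - m1) UNIV"
    using indep_vars_compose2[OF indep, of "\<lambda>_ z. \<phi>1 z - m1" "\<lambda>_. borel"] by simp
  have T: "integrable M (\<lambda>\<omega>. (T \<omega>)\<^sup>2)" "expectation (\<lambda>\<omega>. (T \<omega>)\<^sup>2) = n * (\<integral>z. (\<phi>1 z - m1)\<^sup>2 \<partial>D)"
    using expectation_sum_square_indep[OF indW, of n] I[OF sq1] I[OF i1]
      E[of "\<lambda>z. (\<phi>1 z - m1)\<^sup>2"] E[of \<phi>1] prob_space
    by (auto simp: T_def m1_def)
  have [measurable]: "T \<in> borel_measurable M" unfolding T_def by measurable
  have iT: "integrable M T" by (rule square_integrable_imp_integrable[OF _ T(1)]) simp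
  have iR: "integrable M R" unfolding R_def using I[OF int(2)] by simp
  have "expectation (\<lambda>\<omega>. \<bar>T \<omega>\<bar>) \<le> sqrt (n * (\<integral>z. (\<phi>1 z)\<^sup>2 \<partial>D))"
    using expectation_abs_le_sqrt[OF \<open>T \<in> borel_measurable M\<close> T(1)] unfolding T(2)
    by (rule order_trans) (auto intro!: mult_left_mono var)
  then have "expectation (\<lambda>\<omega>. \<bar>T \<omega>\<bar>) / n \<le> sqrt (n * (\<integral>z. (\<phi>1 z)\<^sup>2 \<partial>D)) / n"
    by (rule divide_right_mono) simp
  also have "\<dots> = sqrt ((\<integral>z. (\<phi>1 z)\<^sup>2 \<partial>D) / n)"
    using n by (simp add: real_sqrt_mult real_sqrt_divide field_simps)
  finally have bT: "expectation (\<lambda>\<omega>. \<bar>T \<omega>\<bar>) / n \<le> sqrt ((\<integral>z. (\<phi>1 z)\<^sup>2 \<partial>D) / n)" .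
  have m2: "\<bar>m2\<bar> \<le> (\<integral>z. \<bar>\<phi>2 z\<bar> \<partial>D)" unfolding m2_def by (rule integral_abs_bound)
  \<comment> \<open>No cancellation is used for the remainder: each summand costs the mean of
    \<open>\<bar>\<phi>2\<bar>\<close> once for the value and once for the centring
    \<open>m2\<close>, whence the factor 2.\<close>
  have "expectation (\<lambda>\<omega>. \<bar>R \<omega>\<bar>) \<le> expectation (\<lambda>\<omega>. \<Sum>i<n. \<bar>\<phi>2 (Z i \<omega>)\<bar> + \<bar>m2\<bar>)"
    using iR I[OF int(2)] unfolding R_def
    by (intro integral_mono Bochner_Integration.integrable_sum Bochner_Integration.integrable_add integrable_abs)
      (auto intro!: order_trans[OF sum_abs] sum_mono abs_triangle_ineq4)
  also have "\<dots> = n * ((\<integral>z. \<bar>\<phi>2 z\<bar> \<partial>D) + \<bar>m2\<bar>)"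
    using I[OF integrable_abs[OF int(2)]] E[of "\<lambda>z. \<bar>\<phi>2 z\<bar>"] prob_space by (simp add: Bochner_Integration.integral_sum)
  also have "\<dots> \<le> n * (2 * (\<integral>z. \<bar>\<phi>2 z\<bar> \<partial>D))" using m2 by (intro mult_left_mono) auto
  finally have bR: "expectation (\<lambda>\<omega>. \<bar>R \<omega>\<bar>) / n \<le> 2 * (\<integral>z. \<bar>\<phi>2 z\<bar> \<partial>D)" using n by (simp add: field_simps)
  have "(\<integral>z. \<phi>1 z + \<phi>2 z \<partial>D) = m1 + m2" unfolding m1_def m2_def using i1 int by simp
  then have "(\<Sum>i<n. \<phi>1 (Z i \<omega>) + \<phi>2 (Z i \<omega>)) / n - (\<integral>z. \<phi>1 z + \<phi>2 z \<partial>D) = (T \<omega> + R \<omega>) / n" for \<omega>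
    using n by (simp add: T_def R_def sum.distrib sum_subtractf field_simps)
  then have "expectation (\<lambda>\<omega>. \<bar>(\<Sum>i<n. \<phi>1 (Z i \<omega>) + \<phi>2 (Z i \<omega>)) / n - (\<integral>z. \<phi>1 z + \<phi>2 z \<partial>D)\<bar>)
      = expectation (\<lambda>\<omega>. \<bar>T \<omega> + R \<omega>\<bar> / n)"
    by simp
  also have "\<dots> \<le> expectation (\<lambda>\<omega>. \<bar>T \<omega>\<bar> / n + \<bar>R \<omega>\<bar> / n)"
    using iT iR by (intro integral_mono) (auto simp: add_divide_distrib[symmetric] intro!: divide_right_mono)
  also have "\<dots> = expectation (\<lambda>\<omega>. \<bar>T \<omega>\<bar>) / n + expectation (\<lambda>\<omega>. \<bar>R \<omega>\<bar>) / n" using iT iR by simp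
  finally show "expectation (\<lambda>\<omega>. \<bar>(\<Sum>i<n. \<phi>1 (Z i \<omega>) + \<phi>2 (Z i \<omega>)) / n - (\<integral>z. \<phi>1 z + \<phi>2 z \<partial>D)\<bar>)
      \<le> sqrt ((\<integral>z. (\<phi>1 z)\<^sup>2 \<partial>D) / n) + 2 * (\<integral>z. \<bar>\<phi>2 z\<bar> \<partial>D)"
    using bT bR by simp
qed

text \<open>The common setting of the population limits and the sample limits. The second
  derivatives of the densities enter through the single bound \<open>G\<close> on \<open>f\<close>,
  and the bandwidth through \<open>h n\<close> tending to 0 and \<open>n * h n\<close> to
  infinity.\<close>

locale kernel_smoothing = prob_space M for M :: "'a measure" +
  fixes X :: "'a \<Rightarrow> real" and Y :: "'a \<Rightarrow> 'w::metric_space"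
    and Xs :: "nat \<Rightarrow> 'a \<Rightarrow> real" and Ys :: "nat \<Rightarrow> 'a \<Rightarrow> 'w"
    and FYX :: "real \<Rightarrow> 'w measure" and f :: "real \<Rightarrow> real" and x G :: real and h :: "nat \<Rightarrow> real"
  assumes X[measurable]: "X \<in> M \<rightarrow>\<^sub>M borel" and Y[measurable]: "Y \<in> M \<rightarrow>\<^sub>M borel"
    and FYX: "is_cond_distr M X Y FYX"
    and indep: "indep_vars (\<lambda>_. borel \<Otimes>\<^sub>M borel) (\<lambda>i \<omega>. (Xs i \<omega>, Ys i \<omega>)) UNIV"
    and distr: "distr M (borel \<Otimes>\<^sub>M borel) (\<lambda>\<omega>. (Xs i \<omega>, Ys i \<omega>)) =
           distr M (borel \<Otimes>\<^sub>M borel) (\<lambda>\<omega>. (X \<omega>, Y \<omega>))"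
    and f_nonneg: "0 \<le> f z" and f_le: "f z \<le> G"
    and f_density: "distributed M lborel X (\<lambda>z. ennreal (f z))"
    and f_cont: "continuous_on UNIV f" and f_pos: "0 < f x"
    and FYX_cont: "open U \<Longrightarrow> continuous_on {z. 0 < f z} (\<lambda>z. measure (FYX z) U)"
    and h_pos: "0 < h n" and h_0: "h \<longlonglongrightarrow> 0" and nh: "filterlim (\<lambda>n. real n * h n) at_top sequentially"
begin

lemma f_measurable[measurable]: "f \<in> borel_measurable borel"
  using f_cont by (rule borel_measurable_continuous_onI)

lemma kernel_integrable_X:
  assumes "integrable lborel \<kappa>"
  shows "integrable M (\<lambda>\<omega>. \<kappa> ((X \<omega> - x) / h n) / h n)"
proof -
  have [measurable]: "\<kappa> \<in> borel_measurable borel" using assms by simp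
  have "integrable lborel (\<lambda>z. f z * (\<kappa> ((z - x) / h n) / h n))"
    using f_nonneg f_le by (intro kernel_integrable[OF h_pos assms, where G = G]) auto
  then show ?thesis
    using f_nonneg by (subst (asm) distributed_integrable[OF f_density]) auto
qed

text \<open>The substitution absorbs the factor \<open>1 / h n\<close>, so that the bound is uniform
  in \<open>n\<close>.\<close>

lemma kernel_expectation_le:
  assumes "integrable lborel \<kappa>" "\<And>u. 0 \<le> \<kappa> u"
  shows "expectation (\<lambda>\<omega>. \<kappa> ((X \<omega> - x) / h n) / h n) \<le> G * (\<integral>u. \<kappa> u \<partial>lborel)"
proof -
  have [measurable]: "\<kappa> \<in> borel_measurable borel" using assms by simp
  have "expectation (\<lambda>\<omega>. \<kappa> ((X \<omega> - x) / h n) / h n) = (\<integral>z. f z * (\<kappa> ((z - x) / h n) / h n) \<partial>lborel)"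
    using f_nonneg by (subst distributed_integral[OF f_density]) auto
  also have "\<dots> = (\<integral>u. f (x + h n * u) * \<kappa> u \<partial>lborel)" by (rule kernel_substitution[OF h_pos])
  also have "\<dots> \<le> (\<integral>u. G * \<kappa> u \<partial>lborel)"
    using assms f_nonneg f_le order_trans[OF f_nonneg f_le]
    by (intro integral_mono Bochner_Integration.integrable_bound[OF integrable_mult_right[OF integrable_norm[OF assms(1)], of G]])
      (auto simp: abs_mult intro!: mult_mono order_trans[OF f_le abs_ge_self])
  finally show ?thesis by simp
qed

text \<open>After conditioning on \<open>X\<close> this is kernel smoothing of the function
  \<open>f z * measure (FYX z) U\<close>, which is bounded by \<open>G\<close> and continuous at
  \<open>x\<close>.\<close>

lemma population_limit:
  assumes \<kappa>: "integrable lborel \<kappa>" and U: "open U"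
  shows "(\<lambda>n. expectation (\<lambda>\<omega>. indicator U (Y \<omega>) * (\<kappa> ((X \<omega> - x) / h n) / h n)))
    \<longlonglongrightarrow> f x * measure (FYX x) U * (\<integral>u. \<kappa> u \<partial>lborel)"
proof -
  have [measurable]: "\<kappa> \<in> borel_measurable borel" "U \<in> sets borel" using \<kappa> U by simp_all
  note [measurable] = borel_measurable_cond_distr[OF FYX \<open>U \<in> sets borel\<close>]
  have p: "0 \<le> measure (FYX z) U" "measure (FYX z) U \<le> 1" for z
    using prob_space_cond_distr(1)[OF FYX] by (auto intro: prob_space.prob_le_1)
  \<comment> \<open>Since this set is open and contains \<open>x\<close>, continuity of the
    conditional probability on it is continuity at \<open>x\<close>.\<close>
  have "open {z. 0 < f z}" using f_cont by (intro open_Collect_less continuous_intros)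
  then have "isCont (\<lambda>z. measure (FYX z) U) x"
    using FYX_cont[OF U] f_pos by (simp add: continuous_on_eq_continuous_at)
  moreover have "isCont f x" using f_cont by (simp add: continuous_on_eq_continuous_at)
  ultimately have cont: "isCont (\<lambda>z. f z * measure (FYX z) U) x" by (intro continuous_intros)
  have bd: "\<bar>f z * measure (FYX z) U\<bar> \<le> G" for z
    using mult_mono[OF f_le[of z] p(2)[of z]] f_nonneg[of z] f_le[of z] p(1)[of z] by (auto simp: abs_mult)
  have eq: "expectation (\<lambda>\<omega>. indicator U (Y \<omega>) * (\<kappa> ((X \<omega> - x) / h n) / h n))
      = (\<integral>z. f z * measure (FYX z) U * (\<kappa> ((z - x) / h n) / h n) \<partial>lborel)" for n
    by (rule cond_distr_integral[OF prob_space_axioms X Y FYX f_density f_nonneg f_measurable]) measurable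
  show ?thesis unfolding eq by (rule kernel_smoothing_limit[OF \<kappa> _ bd cont h_pos h_0]) measurable
qed

text \<open>No square integrability of \<open>\<kappa>\<close> is available, so the mean is split by truncating \<open>\<kappa>\<close> at the level
  \<open>\<surd>(n h)\<close>: this level tends to infinity, but slower than \<open>n h\<close>.\<close>

lemma sample_mean_L1:
  assumes \<kappa>: "integrable lborel \<kappa>" and U: "open U"
  defines "S \<equiv> \<lambda>n \<omega>. (\<Sum>i<n. indicator U (Ys i \<omega>) * (\<kappa> ((Xs i \<omega> - x) / h n) / h n)) / real n"
    and "m \<equiv> \<lambda>n. expectation (\<lambda>\<omega>. indicator U (Y \<omega>) * (\<kappa> ((X \<omega> - x) / h n) / h n))"
  shows "integrable M (S n)" "(\<lambda>n. expectation (\<lambda>\<omega>. \<bar>S n \<omega> - m n\<bar>)) \<longlonglongrightarrow> 0"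
proof -
  have [measurable]: "\<kappa> \<in> borel_measurable borel" "U \<in> sets borel" using \<kappa> U by simp_all
  define T where "T n = sqrt (real n * h n)" for n
  define \<kappa>1 where "\<kappa>1 n u = (if \<bar>\<kappa> u\<bar> \<le> T n then \<kappa> u else 0)" for n u
  define \<kappa>2 where "\<kappa>2 n u = (if \<bar>\<kappa> u\<bar> \<le> T n then 0 else \<kappa> u)" for n u
  have [measurable]: "\<kappa>1 n \<in> borel_measurable borel" "\<kappa>2 n \<in> borel_measurable borel" for n
    unfolding \<kappa>1_def \<kappa>2_def by measurable
  have i2: "integrable lborel (\<lambda>u. \<bar>\<kappa>2 n u\<bar>)" for n
    by (rule Bochner_Integration.integrable_bound[OF \<kappa>]) (auto simp: \<kappa>2_def)
  define \<phi>1 \<phi>2 where "\<phi>1 n = (\<lambda>(z, y). indicator U y * (\<kappa>1 n ((z - x) / h n) / h n))"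
    and "\<phi>2 n = (\<lambda>(z, y). indicator U y * (\<kappa>2 n ((z - x) / h n) / h n))" for n
  have [measurable]: "\<phi>1 n \<in> borel_measurable (borel \<Otimes>\<^sub>M borel)" "\<phi>2 n \<in> borel_measurable (borel \<Otimes>\<^sub>M borel)" for n
    unfolding \<phi>1_def \<phi>2_def by measurable
  let ?N = "borel \<Otimes>\<^sub>M borel :: (real \<times> 'w) measure"
  define D where "D = distr M ?N (\<lambda>\<omega>. (X \<omega>, Y \<omega>))"
  have ED: "(\<integral>z. \<psi> z \<partial>D) = expectation (\<lambda>\<omega>. \<psi> (X \<omega>, Y \<omega>))" and ID: "integrable D \<psi> \<longleftrightarrow> integrable M (\<lambda>\<omega>. \<psi> (X \<omega>, Y \<omega>))"
    if "\<psi> \<in> borel_measurable ?N" for \<psi> :: "_ \<Rightarrow> real"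
    using that by (simp_all add: D_def integral_distr integrable_distr_eq)
  have sum: "\<phi>1 n (z, y) + \<phi>2 n (z, y) = indicator U y * (\<kappa> ((z - x) / h n) / h n)" for n z y
    by (simp add: \<phi>1_def \<phi>2_def \<kappa>1_def \<kappa>2_def)
  have m: "(\<integral>z. \<phi>1 n z + \<phi>2 n z \<partial>D) = m n" for n
    by (subst ED) (auto simp: sum m_def)
  \<comment> \<open>One of the two factors of the truncated kernel is bounded by its level
    \<open>T n\<close>; the other is left for integration.\<close>
  have sq: "(\<phi>1 n (z, y))\<^sup>2 \<le> (T n / h n) * (\<bar>\<kappa> ((z - x) / h n)\<bar> / h n)" for n z y
  proof (cases "y \<in> U \<and> \<bar>\<kappa> ((z - x) / h n)\<bar> \<le> T n")
    case True
    then have "\<bar>\<kappa> ((z - x) / h n)\<bar> * \<bar>\<kappa> ((z - x) / h n)\<bar> \<le> T n * \<bar>\<kappa> ((z - x) / h n)\<bar>" by (intro mult_right_mono) auto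
    with True show ?thesis using h_pos[of n]
      by (auto simp: \<phi>1_def \<kappa>1_def power2_eq_square divide_simps)
  next
    case False
    have "0 \<le> T n" using h_pos[of n] by (simp add: T_def)
    with False show ?thesis using h_pos[of n] by (auto simp: \<phi>1_def \<kappa>1_def)
  qed
  have iabs: "integrable lborel (\<lambda>u. \<bar>\<kappa> u\<bar>)" using \<kappa> by simp
  have ik: "integrable M (\<lambda>\<omega>. (T n / h n) * (\<bar>\<kappa> ((X \<omega> - x) / h n)\<bar> / h n))" for n
    using kernel_integrable_X[OF iabs] by (rule integrable_mult_right)
  have int1: "integrable D (\<lambda>z. (\<phi>1 n z)\<^sup>2)" for n
    by (subst ID, measurable) (rule Bochner_Integration.integrable_bound[OF ik[of n]], measurable,
      rule AE_I2, simp only: real_norm_def abs_power2, rule order_trans[OF sq abs_ge_self])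
  have "(\<integral>z. (\<phi>1 n z)\<^sup>2 \<partial>D) \<le> expectation (\<lambda>\<omega>. (T n / h n) * (\<bar>\<kappa> ((X \<omega> - x) / h n)\<bar> / h n))" for n
    using int1[of n] by (subst ED, measurable, subst (asm) ID, measurable) (intro integral_mono ik sq)
  also have "\<dots> n \<le> (T n / h n) * (G * (\<integral>u. \<bar>\<kappa> u\<bar> \<partial>lborel))" for n
    unfolding integral_mult_right_zero using h_pos[of n]
    by (intro mult_left_mono kernel_expectation_le[OF iabs]) (auto simp: T_def)
  finally have b1: "(\<integral>z. (\<phi>1 n z)\<^sup>2 \<partial>D) \<le> (T n / h n) * (G * (\<integral>u. \<bar>\<kappa> u\<bar> \<partial>lborel))" for n .
  have abs2: "\<bar>\<phi>2 n (z, y)\<bar> \<le> \<bar>\<kappa>2 n ((z - x) / h n)\<bar> / h n" for n z y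
    using h_pos[of n] by (auto simp: \<phi>2_def indicator_def)
  have int2: "integrable D (\<phi>2 n)" for n
    by (subst ID, measurable) (rule Bochner_Integration.integrable_bound[OF kernel_integrable_X[OF i2, of n n]], measurable,
      rule AE_I2, simp only: real_norm_def, rule order_trans[OF abs2 abs_ge_self])
  have b2: "(\<integral>z. \<bar>\<phi>2 n z\<bar> \<partial>D) \<le> G * (\<integral>u. \<bar>\<kappa>2 n u\<bar> \<partial>lborel)" for n
  proof -
    have "(\<integral>z. \<bar>\<phi>2 n z\<bar> \<partial>D) \<le> expectation (\<lambda>\<omega>. \<bar>\<kappa>2 n ((X \<omega> - x) / h n)\<bar> / h n)"
      using integrable_abs[OF int2[of n]]
      by (subst ED, measurable, subst (asm) ID, measurable) (intro integral_mono kernel_integrable_X[OF i2] abs2)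
    also have "\<dots> \<le> G * (\<integral>u. \<bar>\<kappa>2 n u\<bar> \<partial>lborel)" by (rule kernel_expectation_le[OF i2]) simp
    finally show ?thesis .
  qed
  note dev = iid_mean_deviation[OF indep distr[folded D_def] _ _ int1 int2]
  have S_eq: "S n = (\<lambda>\<omega>. (\<Sum>i<n. \<phi>1 n (Xs i \<omega>, Ys i \<omega>) + \<phi>2 n (Xs i \<omega>, Ys i \<omega>)) / real n)" for n
    unfolding S_def sum ..
  show "integrable M (S n)" for n
  proof (cases "n = 0")
    case True then show ?thesis by (simp add: S_def)
  next
    case False then show ?thesis unfolding S_eq by (intro dev) auto
  qed
  \<comment> \<open>Since \<open>T n * T n = n * h n\<close>, the factor
    \<open>T n / h n / n\<close> is the inverse of \<open>T n\<close>, so the first term vanishes in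
    the limit. The second does so by dominated convergence: for each \<open>u\<close> the level
    \<open>T n\<close> eventually exceeds \<open>\<bar>\<kappa> u\<bar>\<close>.\<close>
  define b where "b n = sqrt ((T n / h n) * (G * (\<integral>u. \<bar>\<kappa> u\<bar> \<partial>lborel)) / n) + 2 * (G * (\<integral>u. \<bar>\<kappa>2 n u\<bar> \<partial>lborel))" for n
  have bound: "expectation (\<lambda>\<omega>. \<bar>S n \<omega> - m n\<bar>) \<le> b n" if "0 < n" for n
  proof -
    have "expectation (\<lambda>\<omega>. \<bar>S n \<omega> - m n\<bar>) \<le> sqrt ((\<integral>z. (\<phi>1 n z)\<^sup>2 \<partial>D) / n) + 2 * (\<integral>z. \<bar>\<phi>2 n z\<bar> \<partial>D)"
      using dev(2)[of n n n] that unfolding S_eq m by simp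
    also have "\<dots> \<le> b n"
      unfolding b_def by (intro add_mono real_sqrt_le_mono divide_right_mono b1 mult_left_mono b2) auto
    finally show ?thesis .
  qed
  have T_top: "filterlim T at_top sequentially"
    unfolding T_def by (rule filterlim_compose[OF sqrt_at_top nh])
  have "(\<lambda>n. \<integral>u. \<bar>\<kappa>2 n u\<bar> \<partial>lborel) \<longlonglongrightarrow> (\<integral>u. 0 \<partial>(lborel :: real measure))"
  proof (rule integral_dominated_convergence[where w = "\<lambda>u. \<bar>\<kappa> u\<bar>"])
    show "AE u in lborel. (\<lambda>n. \<bar>\<kappa>2 n u\<bar>) \<longlonglongrightarrow> 0"
    proof (intro AE_I2 tendsto_eventually)
      fix u show "\<forall>\<^sub>F n in sequentially. \<bar>\<kappa>2 n u\<bar> = 0"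
        using T_top[unfolded filterlim_at_top, rule_format, of "\<bar>\<kappa> u\<bar>"] by eventually_elim (simp add: \<kappa>2_def)
    qed
  qed (use iabs in \<open>auto simp: \<kappa>2_def\<close>)
  then have l2: "(\<lambda>n. \<integral>u. \<bar>\<kappa>2 n u\<bar> \<partial>lborel) \<longlonglongrightarrow> 0" by simp
  have "(\<lambda>n. sqrt (inverse (T n) * (G * (\<integral>u. \<bar>\<kappa> u\<bar> \<partial>lborel))) + 2 * (G * (\<integral>u. \<bar>\<kappa>2 n u\<bar> \<partial>lborel)))
     \<longlonglongrightarrow> sqrt (0 * (G * (\<integral>u. \<bar>\<kappa> u\<bar> \<partial>lborel))) + 2 * (G * 0)"
    by (intro tendsto_intros l2 filterlim_compose[OF tendsto_inverse_0_at_top T_top] tendsto_inverse_0_at_top T_top)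
  moreover have "\<forall>\<^sub>F n in sequentially. sqrt (inverse (T n) * (G * (\<integral>u. \<bar>\<kappa> u\<bar> \<partial>lborel))) + 2 * (G * (\<integral>u. \<bar>\<kappa>2 n u\<bar> \<partial>lborel)) = b n"
    using eventually_gt_at_top[of 0]
  proof eventually_elim
    case (elim n)
    have "T n * T n = n * h n" using h_pos[of n] by (simp add: T_def)
    moreover have "0 < T n" using h_pos[of n] elim by (simp add: T_def)
    ultimately have "T n / h n / n = inverse (T n)" using h_pos[of n] elim by (simp add: field_simps)
    then have "(T n / h n) * (G * (\<integral>u. \<bar>\<kappa> u\<bar> \<partial>lborel)) / n = inverse (T n) * (G * (\<integral>u. \<bar>\<kappa> u\<bar> \<partial>lborel))"
      by (metis times_divide_eq_left)
    then show ?case by (simp add: b_def)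
  qed
  ultimately have "b \<longlonglongrightarrow> 0" using tendsto_cong by force
  then show "(\<lambda>n. expectation (\<lambda>\<omega>. \<bar>S n \<omega> - m n\<bar>)) \<longlonglongrightarrow> 0"
    by (rule Lim_null_comparison[rotated])
      (use bound in \<open>auto intro!: eventually_mono[OF eventually_gt_at_top[of 0]] simp: abs_of_nonneg\<close>)
qed

text \<open>The mean distance to the limit is at most the mean fluctuation around the expectation
  \<open>m n\<close>, plus the distance of \<open>m n\<close> from its limit.\<close>

lemma sample_limit:
  assumes \<kappa>: "integrable lborel \<kappa>" and U: "open U"
  shows "((\<lambda>(n, \<omega>). (\<Sum>i<n. indicator U (Ys i \<omega>) * (\<kappa> ((Xs i \<omega> - x) / h n) / h n)) / real n)
    \<longlongrightarrow> f x * measure (FYX x) U * (\<integral>u. \<kappa> u \<partial>lborel)) (prob_filter M)" (is "(_ \<longlongrightarrow> ?L) _")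
proof (rule tendsto_prob_filter_L1)
  define S where "S n \<omega> = (\<Sum>i<n. indicator U (Ys i \<omega>) * (\<kappa> ((Xs i \<omega> - x) / h n) / h n)) / real n" for n \<omega>
  define m where "m n = expectation (\<lambda>\<omega>. indicator U (Y \<omega>) * (\<kappa> ((X \<omega> - x) / h n) / h n))" for n
  note L1 = sample_mean_L1[OF \<kappa> U, folded S_def m_def]
  have S: "integrable M (\<lambda>\<omega>. S n \<omega>)" for n using L1(1)[of n] by simp
  show "integrable M (\<lambda>\<omega>. (\<Sum>i<n. indicator U (Ys i \<omega>) * (\<kappa> ((Xs i \<omega> - x) / h n) / h n)) / real n)" for n
    using S unfolding S_def .
  have "expectation (\<lambda>\<omega>. \<bar>S n \<omega> - ?L\<bar>) \<le> expectation (\<lambda>\<omega>. \<bar>S n \<omega> - m n\<bar>) + \<bar>m n - ?L\<bar>" for n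
  proof -
    have "expectation (\<lambda>\<omega>. \<bar>S n \<omega> - ?L\<bar>) \<le> expectation (\<lambda>\<omega>. \<bar>S n \<omega> - m n\<bar> + \<bar>m n - ?L\<bar>)"
      using S[of n] by (intro integral_mono) auto
    then show ?thesis using S[of n] prob_space by simp
  qed
  moreover have "(\<lambda>n. \<bar>m n - ?L\<bar>) \<longlonglongrightarrow> 0"
    using population_limit[OF \<kappa> U] unfolding m_def by (intro tendsto_rabs_zero LIM_zero)
  then have "(\<lambda>n. expectation (\<lambda>\<omega>. \<bar>S n \<omega> - m n\<bar>) + \<bar>m n - ?L\<bar>) \<longlonglongrightarrow> 0"
    using tendsto_add[OF L1(2)] by fastforce
  ultimately have "(\<lambda>n. expectation (\<lambda>\<omega>. \<bar>S n \<omega> - ?L\<bar>)) \<longlonglongrightarrow> 0"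
    by (intro Lim_null_comparison[where f = "\<lambda>n. expectation (\<lambda>\<omega>. \<bar>S n \<omega> - ?L\<bar>)"])
      (auto simp: abs_of_nonneg)
  then show "(\<lambda>n. expectation (\<lambda>\<omega>. \<bar>(\<Sum>i<n. indicator U (Ys i \<omega>) * (\<kappa> ((Xs i \<omega> - x) / h n) / h n)) / real n - ?L\<bar>)) \<longlonglongrightarrow> 0"
    unfolding S_def .
qed (rule prob_space_axioms)

end

section \<open>Local linear weights\<close>

lemma borel_measurable_inner_feature:
  fixes \<Phi> :: "'w::metric_space \<Rightarrow> 'h::real_inner"
  assumes "continuous_on UNIV \<Phi>"
  shows "(\<lambda>y. \<Phi> y \<bullet> v) \<in> borel_measurable borel" "(\<lambda>y. (norm (\<Phi> y - v))\<^sup>2) \<in> borel_measurable borel"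
  using assms by (auto intro!: borel_measurable_continuous_onI continuous_intros)

lemma integrable_mult_bounded:
  fixes s q :: "'b \<Rightarrow> real"
  assumes s: "integrable N s" and [measurable]: "q \<in> borel_measurable N" and q: "\<And>\<omega>. \<bar>q \<omega>\<bar> \<le> B"
  shows "integrable N (\<lambda>\<omega>. s \<omega> * q \<omega>)"
proof -
  have [measurable]: "s \<in> borel_measurable N" using s by simp
  show ?thesis
    by (rule Bochner_Integration.integrable_bound[OF integrable_mult_left[OF s, of B]])
      (auto simp: abs_mult intro!: mult_left_mono order_trans[OF q abs_ge_self])
qed

text \<open>For a step function the weighted mean involves only the weights of the sets
  \<open>V l\<close>. Since \<open>s\<close> may be signed, the approximation error is controlled by
  its total absolute mass and not by its integral.\<close>

lemma weighted_step_approximation: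
  fixes \<Phi> :: "'w::metric_space \<Rightarrow> 'h::real_inner" and s :: "'b \<Rightarrow> real"
  assumes s: "integrable N s" and \<zeta>[measurable]: "\<zeta> \<in> N \<rightarrow>\<^sub>M borel"
    and \<Phi>: "continuous_on UNIV \<Phi>" "\<And>y. norm (\<Phi> y) \<le> B" and V: "\<And>l. open (V l)"
    and e: "\<And>y. norm (\<Phi> y - (\<Sum>l<m. (indicator (V (Suc l)) y - indicator (V l) y) *\<^sub>R \<Phi> (w l))) \<le> e"
  shows "\<bar>(\<integral>\<omega>. s \<omega> * (\<Phi> (\<zeta> \<omega>) \<bullet> v) \<partial>N) -
     (\<Sum>l<m. ((\<integral>\<omega>. indicator (V (Suc l)) (\<zeta> \<omega>) * s \<omega> \<partial>N)
       - (\<integral>\<omega>. indicator (V l) (\<zeta> \<omega>) * s \<omega> \<partial>N)) *\<^sub>R \<Phi> (w l)) \<bullet> v\<bar>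
    \<le> e * norm v * (\<integral>\<omega>. \<bar>s \<omega>\<bar> \<partial>N)"
proof -
  note [measurable] = borel_measurable_inner_feature(1)[OF \<Phi>(1), of v] borel_open[OF V]
  have [measurable]: "s \<in> borel_measurable N" using s by simp
  have iV: "integrable N (\<lambda>\<omega>. indicator (V l) (\<zeta> \<omega>) * s \<omega>)" for l
    using integrable_mult_bounded[OF s, of "\<lambda>\<omega>. indicator (V l) (\<zeta> \<omega>)" 1] by (simp add: mult.commute indicator_def)
  have i\<Phi>: "integrable N (\<lambda>\<omega>. s \<omega> * (\<Phi> (\<zeta> \<omega>) \<bullet> v))"
    by (rule integrable_mult_bounded[OF s, where B = "B * norm v"])
      (auto intro!: order_trans[OF Cauchy_Schwarz_ineq2] mult_right_mono \<Phi>)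
  define \<psi> where "\<psi> y = (\<Sum>l<m. (indicator (V (Suc l)) y - indicator (V l) y) *\<^sub>R \<Phi> (w l))" for y
  have \<psi>: "s \<omega> * (\<psi> (\<zeta> \<omega>) \<bullet> v) = (\<Sum>l<m. (indicator (V (Suc l)) (\<zeta> \<omega>) * s \<omega> - indicator (V l) (\<zeta> \<omega>) * s \<omega>) * (\<Phi> (w l) \<bullet> v))" for \<omega>
    unfolding \<psi>_def inner_sum_left inner_scaleR_left sum_distrib_left by (intro sum.cong) (auto simp: algebra_simps)
  have i\<psi>: "integrable N (\<lambda>\<omega>. s \<omega> * (\<psi> (\<zeta> \<omega>) \<bullet> v))"
    unfolding \<psi> using iV by (intro Bochner_Integration.integrable_sum integrable_mult_left Bochner_Integration.integrable_diff)
  have "(\<integral>\<omega>. s \<omega> * (\<psi> (\<zeta> \<omega>) \<bullet> v) \<partial>N) = (\<Sum>l<m. ((\<integral>\<omega>. indicator (V (Suc l)) (\<zeta> \<omega>) * s \<omega> \<partial>N)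
       - (\<integral>\<omega>. indicator (V l) (\<zeta> \<omega>) * s \<omega> \<partial>N)) *\<^sub>R \<Phi> (w l)) \<bullet> v"
    unfolding \<psi> inner_sum_left inner_scaleR_left using iV
    by (subst Bochner_Integration.integral_sum) (auto simp: Bochner_Integration.integral_diff)
  then have "\<bar>(\<integral>\<omega>. s \<omega> * (\<Phi> (\<zeta> \<omega>) \<bullet> v) \<partial>N) -
     (\<Sum>l<m. ((\<integral>\<omega>. indicator (V (Suc l)) (\<zeta> \<omega>) * s \<omega> \<partial>N)
       - (\<integral>\<omega>. indicator (V l) (\<zeta> \<omega>) * s \<omega> \<partial>N)) *\<^sub>R \<Phi> (w l)) \<bullet> v\<bar>
     = \<bar>\<integral>\<omega>. s \<omega> * (\<Phi> (\<zeta> \<omega>) \<bullet> v) - s \<omega> * (\<psi> (\<zeta> \<omega>) \<bullet> v) \<partial>N\<bar>"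
    using i\<Phi> i\<psi> by simp
  also have "\<dots> \<le> (\<integral>\<omega>. \<bar>s \<omega> * (\<Phi> (\<zeta> \<omega>) \<bullet> v) - s \<omega> * (\<psi> (\<zeta> \<omega>) \<bullet> v)\<bar> \<partial>N)" by (rule integral_abs_bound)
  also have "\<dots> \<le> (\<integral>\<omega>. (e * norm v) * \<bar>s \<omega>\<bar> \<partial>N)"
  proof (rule integral_mono)
    fix \<omega>
    have "\<bar>s \<omega> * (\<Phi> (\<zeta> \<omega>) \<bullet> v) - s \<omega> * (\<psi> (\<zeta> \<omega>) \<bullet> v)\<bar> = \<bar>s \<omega>\<bar> * \<bar>(\<Phi> (\<zeta> \<omega>) - \<psi> (\<zeta> \<omega>)) \<bullet> v\<bar>"
      by (simp add: inner_diff_left abs_mult flip: right_diff_distrib)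
    also have "\<dots> \<le> \<bar>s \<omega>\<bar> * (e * norm v)"
      using e[of "\<zeta> \<omega>"] by (intro mult_left_mono order_trans[OF Cauchy_Schwarz_ineq2] mult_right_mono) (auto simp: \<psi>_def)
    finally show "\<bar>s \<omega> * (\<Phi> (\<zeta> \<omega>) \<bullet> v) - s \<omega> * (\<psi> (\<zeta> \<omega>) \<bullet> v)\<bar> \<le> (e * norm v) * \<bar>s \<omega>\<bar>" by (simp add: mult.commute)
  qed (use i\<Phi> i\<psi> s in auto)
  also have "\<dots> = e * norm v * (\<integral>\<omega>. \<bar>s \<omega>\<bar> \<partial>N)" by simp
  finally show ?thesis .
qed

text \<open>Unlike \<open>pop_mu\<close>, which is of order \<open>h ^ j\<close>, these moments have a limit as \<open>h\<close> tends to \<open>0\<close>: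
  the density at \<open>x\<close> times the moment of \<open>K\<close>.\<close>

definition scaled_mu :: "'a measure \<Rightarrow> ('a \<Rightarrow> real) \<Rightarrow> (real \<Rightarrow> real) \<Rightarrow> real \<Rightarrow> real \<Rightarrow> nat \<Rightarrow> real" where
  "scaled_mu M X K x h j = (\<integral>\<omega>. K ((X \<omega> - x) / h) * ((X \<omega> - x) / h) ^ j / h \<partial>M)"

definition scaled_sigma2 :: "'a measure \<Rightarrow> ('a \<Rightarrow> real) \<Rightarrow> (real \<Rightarrow> real) \<Rightarrow> real \<Rightarrow> real \<Rightarrow> real" where
  "scaled_sigma2 M X K x h = scaled_mu M X K x h 0 * scaled_mu M X K x h 2 - (scaled_mu M X K x h 1)\<^sup>2"

lemma pop_mu_scaled:
  assumes "0 < h" shows "pop_mu M X K x h j = h ^ j * scaled_mu M X K x h j"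
  unfolding pop_mu_def scaled_mu_def K_scaled_def using assms
  by (subst integral_mult_right_zero[symmetric]) (auto simp: power_divide intro!: Bochner_Integration.integral_cong)

lemma pop_sigma2_scaled: "0 < h \<Longrightarrow> pop_sigma2 M X K x h = h\<^sup>2 * scaled_sigma2 M X K x h"
  by (simp add: pop_sigma2_def scaled_sigma2_def pop_mu_scaled power2_eq_square algebra_simps)

text \<open>Numerator and denominator both carry the factor \<open>h\<^sup>2\<close>, which cancels.
  The powers \<open>^ 0\<close> and \<open>^ 1\<close> stay unevaluated to match the integrands of
  \<open>scaled_mu\<close>.\<close>

lemma pop_s_scaled:
  assumes "0 < h"
  shows "pop_s M X K x h z = (K ((z - x) / h) * ((z - x) / h) ^ 0 / h * scaled_mu M X K x h 2
     - K ((z - x) / h) * ((z - x) / h) ^ 1 / h * scaled_mu M X K x h 1) / scaled_sigma2 M X K x h"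
proof -
  have "K_scaled K h (z - x) * (pop_mu M X K x h 2 - pop_mu M X K x h 1 * (z - x))
     = h\<^sup>2 * (K ((z - x) / h) * ((z - x) / h) ^ 0 / h * scaled_mu M X K x h 2
     - K ((z - x) / h) * ((z - x) / h) ^ 1 / h * scaled_mu M X K x h 1)"
    using assms by (simp add: K_scaled_def pop_mu_scaled field_simps power2_eq_square)
  then show ?thesis using assms by (simp add: pop_s_def pop_sigma2_scaled)
qed

text \<open>\<open>N\<close> is an arbitrary measure, so that it can be \<open>M\<close> with the
  variable \<open>X\<close>, or the uniform measure on the indices of a sample with the observed
  values, including the null measure of the empty sample.\<close>

context
  fixes N :: "'b measure" and \<xi> :: "'b \<Rightarrow> real" and K :: "real \<Rightarrow> real" and x h :: real
  assumes h: "0 < h" and int: "\<And>j. j \<le> 2 \<Longrightarrow> integrable N (\<lambda>\<omega>. K ((\<xi> \<omega> - x) / h) * ((\<xi> \<omega> - x) / h) ^ j / h)"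
begin

lemma integrable_pop_s: "integrable N (\<lambda>\<omega>. pop_s N \<xi> K x h (\<xi> \<omega>))"
  unfolding pop_s_scaled[OF h]
  by (intro integrable_divide Bochner_Integration.integrable_diff integrable_mult_left int) auto

lemma integral_indicator_pop_s:
  assumes [measurable]: "\<zeta> \<in> N \<rightarrow>\<^sub>M borel" "U \<in> sets borel"
  shows "(\<integral>\<omega>. indicator U (\<zeta> \<omega>) * pop_s N \<xi> K x h (\<xi> \<omega>) \<partial>N) =
    ((\<integral>\<omega>. indicator U (\<zeta> \<omega>) * (K ((\<xi> \<omega> - x) / h) * ((\<xi> \<omega> - x) / h) ^ 0 / h) \<partial>N) * scaled_mu N \<xi> K x h 2
     - (\<integral>\<omega>. indicator U (\<zeta> \<omega>) * (K ((\<xi> \<omega> - x) / h) * ((\<xi> \<omega> - x) / h) ^ 1 / h) \<partial>N) * scaled_mu N \<xi> K x h 1)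
      / scaled_sigma2 N \<xi> K x h"
proof -
  have i: "integrable N (\<lambda>\<omega>. indicator U (\<zeta> \<omega>) * (K ((\<xi> \<omega> - x) / h) * ((\<xi> \<omega> - x) / h) ^ j / h))" if "j \<le> 2" for j
    using integrable_mult_bounded[OF int[OF that], of "\<lambda>\<omega>. indicator U (\<zeta> \<omega>)" 1] by (simp add: mult.commute indicator_def)
  have distrib: "a * ((b * c - b' * c') / d) = (a * b * c - a * b' * c') / d" for a b c b' c' d :: real
    by (simp add: right_diff_distrib mult.assoc)
  have "(\<integral>\<omega>. indicator U (\<zeta> \<omega>) * pop_s N \<xi> K x h (\<xi> \<omega>) \<partial>N) =
     (\<integral>\<omega>. (indicator U (\<zeta> \<omega>) * (K ((\<xi> \<omega> - x) / h) * ((\<xi> \<omega> - x) / h) ^ 0 / h) * scaled_mu N \<xi> K x h 2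
     - indicator U (\<zeta> \<omega>) * (K ((\<xi> \<omega> - x) / h) * ((\<xi> \<omega> - x) / h) ^ 1 / h) * scaled_mu N \<xi> K x h 1)
      / scaled_sigma2 N \<xi> K x h \<partial>N)"
    unfolding pop_s_scaled[OF h] distrib ..
  also have "\<dots> = ((\<integral>\<omega>. indicator U (\<zeta> \<omega>) * (K ((\<xi> \<omega> - x) / h) * ((\<xi> \<omega> - x) / h) ^ 0 / h) * scaled_mu N \<xi> K x h 2 \<partial>N)
     - (\<integral>\<omega>. indicator U (\<zeta> \<omega>) * (K ((\<xi> \<omega> - x) / h) * ((\<xi> \<omega> - x) / h) ^ 1 / h) * scaled_mu N \<xi> K x h 1 \<partial>N))
      / scaled_sigma2 N \<xi> K x h"
    by (subst integral_divide_zero, subst Bochner_Integration.integral_diff)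
      ((intro integrable_mult_left i; simp)+, rule refl)
  finally show ?thesis unfolding integral_mult_left_zero .
qed

text \<open>The case \<open>U = UNIV\<close> of the preceding formula, with a dummy constant for
  \<open>\<zeta>\<close>: the numerator becomes the determinant
  \<open>scaled_sigma2\<close>.\<close>

lemma integral_pop_s:
  assumes "scaled_sigma2 N \<xi> K x h \<noteq> 0"
  shows "(\<integral>\<omega>. pop_s N \<xi> K x h (\<xi> \<omega>) \<partial>N) = 1"
proof -
  have "(\<integral>\<omega>. pop_s N \<xi> K x h (\<xi> \<omega>) \<partial>N)
    = (scaled_mu N \<xi> K x h 0 * scaled_mu N \<xi> K x h 2 - scaled_mu N \<xi> K x h 1 * scaled_mu N \<xi> K x h 1)
      / scaled_sigma2 N \<xi> K x h"
    using integral_indicator_pop_s[of "\<lambda>_. 0 :: real" UNIV] by (simp add: scaled_mu_def)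
  then show ?thesis using assms by (simp add: scaled_sigma2_def power2_eq_square)
qed

text \<open>The weights may be negative, so their integral does not bound their absolute mass. The
  triangle inequality does, in terms of quantities that converge.\<close>

lemma integral_abs_pop_s_le:
  assumes K: "\<And>u. 0 \<le> K u"
  shows "(\<integral>\<omega>. \<bar>pop_s N \<xi> K x h (\<xi> \<omega>)\<bar> \<partial>N) \<le>
    (scaled_mu N \<xi> K x h 0 * \<bar>scaled_mu N \<xi> K x h 2\<bar>
     + (\<integral>\<omega>. \<bar>K ((\<xi> \<omega> - x) / h) * ((\<xi> \<omega> - x) / h) ^ 1 / h\<bar> \<partial>N) * \<bar>scaled_mu N \<xi> K x h 1\<bar>)
     / \<bar>scaled_sigma2 N \<xi> K x h\<bar>"
proof -
  have "(\<integral>\<omega>. \<bar>pop_s N \<xi> K x h (\<xi> \<omega>)\<bar> \<partial>N) \<le>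
    (\<integral>\<omega>. (K ((\<xi> \<omega> - x) / h) * ((\<xi> \<omega> - x) / h) ^ 0 / h * \<bar>scaled_mu N \<xi> K x h 2\<bar>
     + \<bar>K ((\<xi> \<omega> - x) / h) * ((\<xi> \<omega> - x) / h) ^ 1 / h\<bar> * \<bar>scaled_mu N \<xi> K x h 1\<bar>)
     / \<bar>scaled_sigma2 N \<xi> K x h\<bar> \<partial>N)"
  proof (rule integral_mono)
    fix \<omega>
    have "K ((\<xi> \<omega> - x) / h) * ((\<xi> \<omega> - x) / h) ^ 0 / h * \<bar>scaled_mu N \<xi> K x h 2\<bar>
      = \<bar>K ((\<xi> \<omega> - x) / h) * ((\<xi> \<omega> - x) / h) ^ 0 / h * scaled_mu N \<xi> K x h 2\<bar>"
      using K h by (simp add: abs_mult)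
    then show "\<bar>pop_s N \<xi> K x h (\<xi> \<omega>)\<bar> \<le> (K ((\<xi> \<omega> - x) / h) * ((\<xi> \<omega> - x) / h) ^ 0 / h * \<bar>scaled_mu N \<xi> K x h 2\<bar>
     + \<bar>K ((\<xi> \<omega> - x) / h) * ((\<xi> \<omega> - x) / h) ^ 1 / h\<bar> * \<bar>scaled_mu N \<xi> K x h 1\<bar>)
     / \<bar>scaled_sigma2 N \<xi> K x h\<bar>"
      unfolding pop_s_scaled[OF h] abs_divide[of _ "scaled_sigma2 N \<xi> K x h"] abs_mult[of _ "scaled_mu N \<xi> K x h 1", symmetric]
      by (intro divide_right_mono) (simp_all only: abs_triangle_ineq4 abs_ge_zero)
  next
    show "integrable N (\<lambda>\<omega>. (K ((\<xi> \<omega> - x) / h) * ((\<xi> \<omega> - x) / h) ^ 0 / h * \<bar>scaled_mu N \<xi> K x h 2\<bar>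
     + \<bar>K ((\<xi> \<omega> - x) / h) * ((\<xi> \<omega> - x) / h) ^ 1 / h\<bar> * \<bar>scaled_mu N \<xi> K x h 1\<bar>)
     / \<bar>scaled_sigma2 N \<xi> K x h\<bar>)"
      by (intro integrable_divide Bochner_Integration.integrable_add integrable_mult_left integrable_abs int) auto
  qed (rule integrable_abs[OF integrable_pop_s])
  also have "\<dots> = (scaled_mu N \<xi> K x h 0 * \<bar>scaled_mu N \<xi> K x h 2\<bar>
     + (\<integral>\<omega>. \<bar>K ((\<xi> \<omega> - x) / h) * ((\<xi> \<omega> - x) / h) ^ 1 / h\<bar> \<partial>N) * \<bar>scaled_mu N \<xi> K x h 1\<bar>)
     / \<bar>scaled_sigma2 N \<xi> K x h\<bar>"
    unfolding integral_divide_zero scaled_mu_def[of N \<xi> K x h 0]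
    by (subst Bochner_Integration.integral_add) 
      ((intro integrable_mult_left integrable_abs int; simp)+, simp only: integral_mult_left_zero integral_divide_zero)
  finally show ?thesis .
qed

end

text \<open>As \<open>\<mu> 1 = 0\<close>, the weight of an open set \<open>U\<close> tends to
  \<open>c * measure P U * (c * \<mu> 2)\<close> over \<open>c * (c * \<mu> 2)\<close>, so that the
  density \<open>c\<close> cancels and \<open>measure P U\<close> remains. Step functions carry this
  over to \<open>\<Phi>\<close>, as the absolute mass of the weights stays bounded. The estimate is
  uniform in \<open>v\<close>, which allows it to be turned into one for norms.\<close>

lemma local_linear_limit:
  fixes N :: "'i \<Rightarrow> 'b measure" and \<xi> :: "'i \<Rightarrow> 'b \<Rightarrow> real" and \<zeta> :: "'i \<Rightarrow> 'b \<Rightarrow> 'w::metric_space"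
    and h :: "'i \<Rightarrow> real" and \<Phi> :: "'w \<Rightarrow> 'h::real_inner" and \<mu> :: "nat \<Rightarrow> real" and P :: "'w measure"
    and K :: "real \<Rightarrow> real" and x :: real
  defines "W \<equiv> \<lambda>j i \<omega>. K ((\<xi> i \<omega> - x) / h i) * ((\<xi> i \<omega> - x) / h i) ^ j / h i"
  assumes h: "\<And>i. 0 < h i" and K: "\<And>u. 0 \<le> K u"
    and \<zeta>: "\<And>i. \<zeta> i \<in> N i \<rightarrow>\<^sub>M borel" and int: "\<And>i j. j \<le> 2 \<Longrightarrow> integrable (N i) (W j i)"
    and lim: "\<And>U j. open U \<Longrightarrow> j \<le> 2 \<Longrightarrow>
      ((\<lambda>i. \<integral>\<omega>. indicator U (\<zeta> i \<omega>) * W j i \<omega> \<partial>N i) \<longlongrightarrow> c * measure P U * \<mu> j) F"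
    and lim_abs: "((\<lambda>i. \<integral>\<omega>. \<bar>W 1 i \<omega>\<bar> \<partial>N i) \<longlongrightarrow> c') F"
    and \<mu>: "\<mu> 0 = 1" "\<mu> 1 = 0" "0 < \<mu> 2" and c: "0 < c"
    and \<Phi>: "continuous_on UNIV \<Phi>" "\<And>y. norm (\<Phi> y) \<le> B" and cpt: "compact (UNIV :: 'w set)"
    and P: "prob_space P" "sets P = sets borel" and \<theta>: "\<And>v. (\<integral>y. \<Phi> y \<bullet> v \<partial>P) = \<theta> \<bullet> v" and e: "0 < e"
  shows "\<forall>\<^sub>F i in F. 0 < scaled_sigma2 (N i) (\<xi> i) K x (h i)"
    and "\<forall>\<^sub>F i in F. \<forall>v. \<bar>(\<integral>\<omega>. pop_s (N i) (\<xi> i) K x (h i) (\<xi> i \<omega>) * (\<Phi> (\<zeta> i \<omega>) \<bullet> v) \<partial>N i) - \<theta> \<bullet> v\<bar> \<le> e * norm v"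
proof -
  interpret P: prob_space P by fact
  define A where "A j i = scaled_mu (N i) (\<xi> i) K x (h i) j" for j i
  define \<Delta> where "\<Delta> i = scaled_sigma2 (N i) (\<xi> i) K x (h i)" for i
  define s where "s i \<omega> = pop_s (N i) (\<xi> i) K x (h i) (\<xi> i \<omega>)" for i \<omega>
  define b where "b U j i = (\<integral>\<omega>. indicator U (\<zeta> i \<omega>) * W j i \<omega> \<partial>N i)" for U j i
  define \<beta> where "\<beta> U i = (\<integral>\<omega>. indicator U (\<zeta> i \<omega>) * s i \<omega> \<partial>N i)" for U i
  define D where "D i = (\<integral>\<omega>. \<bar>W 1 i \<omega>\<bar> \<partial>N i)" for i
  have b: "(b U j \<longlongrightarrow> c * measure P U * \<mu> j) F" if "open U" "j \<le> 2" for U j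
    using lim[OF that] unfolding b_def .
  have "space P = UNIV" using sets_eq_imp_space_eq[OF P(2)] by simp
  then have "measure P UNIV = 1" using P.prob_space by simp
  then have A: "(A j \<longlongrightarrow> c * \<mu> j) F" if "j \<le> 2" for j
    using lim[of UNIV j] that unfolding A_def scaled_mu_def W_def by simp
  have D: "(D \<longlongrightarrow> c') F" using lim_abs unfolding D_def .
  have \<Delta>_eq: "\<Delta> i = A 0 i * A 2 i - (A 1 i)\<^sup>2" for i by (simp add: \<Delta>_def A_def scaled_sigma2_def)
  have c2: "c * 1 * (c * \<mu> 2) - (c * 0)\<^sup>2 > 0" using c \<mu> by simp
  have \<Delta>: "(\<Delta> \<longlongrightarrow> c * 1 * (c * \<mu> 2) - (c * 0)\<^sup>2) F"
    unfolding \<Delta>_eq[abs_def] using A[of 0] A[of 1] A[of 2] unfolding \<mu> by (intro tendsto_intros) auto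
  show pos: "\<forall>\<^sub>F i in F. 0 < scaled_sigma2 (N i) (\<xi> i) K x (h i)"
    using order_tendstoD(1)[OF \<Delta> c2] unfolding \<Delta>_def .
  note int' = int[unfolded W_def]
  have \<beta>_eq: "\<beta> U i = (b U 0 i * A 2 i - b U 1 i * A 1 i) / \<Delta> i" if "open U" for U i
    unfolding \<beta>_def b_def A_def \<Delta>_def s_def W_def
    using that by (intro integral_indicator_pop_s[OF h int' \<zeta>]) auto
  have \<beta>: "(\<beta> U \<longlongrightarrow> measure P U) F" if "open U" for U
  proof -
    have "((\<lambda>i. (b U 0 i * A 2 i - b U 1 i * A 1 i) / \<Delta> i) \<longlongrightarrow>
      (c * measure P U * 1 * (c * \<mu> 2) - c * measure P U * 0 * (c * 0)) / (c * 1 * (c * \<mu> 2) - (c * 0)\<^sup>2)) F"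
      using A[of 1] A[of 2] b[OF that, of 0] b[OF that, of 1] \<Delta> c2 unfolding \<mu>
      by (intro tendsto_intros) auto
    moreover have "(c * measure P U * 1 * (c * \<mu> 2) - c * measure P U * 0 * (c * 0)) / (c * 1 * (c * \<mu> 2) - (c * 0)\<^sup>2) = measure P U"
      using c \<mu> by simp
    ultimately show ?thesis unfolding \<beta>_eq[OF that, abs_def] by (simp only:)
  qed
  have "((\<lambda>i. (A 0 i * \<bar>A 2 i\<bar> + D i * \<bar>A 1 i\<bar>) / \<bar>\<Delta> i\<bar>) \<longlongrightarrow>
      (c * 1 * \<bar>c * \<mu> 2\<bar> + c' * \<bar>c * 0\<bar>) / \<bar>c * 1 * (c * \<mu> 2) - (c * 0)\<^sup>2\<bar>) F"
    using A[of 0] A[of 1] A[of 2] D \<Delta> c2 unfolding \<mu> by (intro tendsto_intros) auto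
  \<comment> \<open>The limit of the bound is 1, because \<open>c'\<close> is multiplied by 0; so 2
    is an eventual bound for the absolute mass.\<close>
  moreover have "(c * 1 * \<bar>c * \<mu> 2\<bar> + c' * \<bar>c * 0\<bar>) / \<bar>c * 1 * (c * \<mu> 2) - (c * 0)\<^sup>2\<bar> < 2"
    using c \<mu> by (simp add: abs_mult)
  ultimately have "\<forall>\<^sub>F i in F. (A 0 i * \<bar>A 2 i\<bar> + D i * \<bar>A 1 i\<bar>) / \<bar>\<Delta> i\<bar> < 2"
    by (rule order_tendstoD(2))
  then have s2: "\<forall>\<^sub>F i in F. (\<integral>\<omega>. \<bar>s i \<omega>\<bar> \<partial>N i) \<le> 2"
  proof eventually_elim
    case (elim i)
    have "(\<integral>\<omega>. \<bar>s i \<omega>\<bar> \<partial>N i) \<le> (A 0 i * \<bar>A 2 i\<bar> + D i * \<bar>A 1 i\<bar>) / \<bar>\<Delta> i\<bar>"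
      unfolding s_def A_def D_def \<Delta>_def W_def by (rule integral_abs_pop_s_le[OF h int' K])
    with elim show ?case by simp
  qed
  \<comment> \<open>The error \<open>e\<close> is spent as follows: \<open>e / 4\<close> times the
    mass bound 2 for the step function under the weights, \<open>e / 4\<close> for the convergence
    of its weighted mean, and \<open>e / 4\<close> for the step function under
    \<open>P\<close>.\<close>
  obtain m V w where V: "\<And>l. open (V l)"
    and step: "\<And>y. norm (\<Phi> y - (\<Sum>l<m. (indicator (V (Suc l)) y - indicator (V l) y) *\<^sub>R \<Phi> (w l))) \<le> e / 4"
    by (rule compact_step_approximation[OF \<Phi>(1) cpt, of "e / 4"]) (use e in simp, rule that, assumption+)
  \<comment> \<open>The mean of the same step function under \<open>P\<close> and, as
    \<open>g i\<close>, under the weights. Finitely many real coefficients of fixed vectors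
    converge, so \<open>g\<close> converges to \<open>\<theta>'\<close> in norm.\<close>
  define \<theta>' where "\<theta>' = (\<Sum>l<m. (measure P (V (Suc l)) - measure P (V l)) *\<^sub>R \<Phi> (w l))"
  define g where "g i = (\<Sum>l<m. (\<beta> (V (Suc l)) i - \<beta> (V l) i) *\<^sub>R \<Phi> (w l))" for i
  have \<theta>': "\<bar>\<theta> \<bullet> v - \<theta>' \<bullet> v\<bar> \<le> e / 4 * norm v" for v
  proof -
    have ind: "(\<integral>y. indicator (V l) y \<partial>P) = measure P (V l)" for l
      using V[of l] P(2) \<open>space P = UNIV\<close> by simp
    have "(\<lambda>y. y) \<in> P \<rightarrow>\<^sub>M borel" using P(2) by (simp add: measurable_ident_sets)
    from weighted_step_approximation[OF _ this \<Phi> V step, of "\<lambda>_. 1" v]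
    show ?thesis using \<theta>[of v] P.prob_space by (simp add: ind \<theta>'_def \<open>space P = UNIV\<close>)
  qed
  have "(g \<longlongrightarrow> \<theta>') F"
    unfolding g_def[abs_def] \<theta>'_def by (intro tendsto_intros \<beta> V)
  from tendstoD[OF this, of "e / 4"] have "\<forall>\<^sub>F i in F. norm (g i - \<theta>') < e / 4"
    using e by (simp add: dist_norm)
  with s2 show "\<forall>\<^sub>F i in F. \<forall>v. \<bar>(\<integral>\<omega>. pop_s (N i) (\<xi> i) K x (h i) (\<xi> i \<omega>) * (\<Phi> (\<zeta> i \<omega>) \<bullet> v) \<partial>N i) - \<theta> \<bullet> v\<bar> \<le> e * norm v"
  proof eventually_elim
    case (elim i)
    show ?case
    proof
      fix v
      have "\<bar>(\<integral>\<omega>. s i \<omega> * (\<Phi> (\<zeta> i \<omega>) \<bullet> v) \<partial>N i) - g i \<bullet> v\<bar> \<le> e / 4 * norm v * (\<integral>\<omega>. \<bar>s i \<omega>\<bar> \<partial>N i)"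
        unfolding g_def \<beta>_def
        by (rule weighted_step_approximation[OF _ \<zeta> \<Phi> V step])
          (unfold s_def, rule integrable_pop_s[OF h int'])
      also have "\<dots> \<le> e / 4 * norm v * 2" using elim(1) e by (intro mult_left_mono) auto
      finally have 1: "\<bar>(\<integral>\<omega>. s i \<omega> * (\<Phi> (\<zeta> i \<omega>) \<bullet> v) \<partial>N i) - g i \<bullet> v\<bar> \<le> e / 2 * norm v" by simp
      have "\<bar>g i \<bullet> v - \<theta>' \<bullet> v\<bar> \<le> norm (g i - \<theta>') * norm v"
        unfolding inner_diff_left[symmetric] by (rule Cauchy_Schwarz_ineq2)
      also have "\<dots> \<le> e / 4 * norm v" using elim(2) by (intro mult_right_mono) auto
      finally show "\<bar>(\<integral>\<omega>. pop_s (N i) (\<xi> i) K x (h i) (\<xi> i \<omega>) * (\<Phi> (\<zeta> i \<omega>) \<bullet> v) \<partial>N i) - \<theta> \<bullet> v\<bar> \<le> e * norm v"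
        using 1 \<theta>'[of v] unfolding s_def by linarith
    qed
  qed
qed

text \<open>As the weights integrate to 1, the quadratic term is exactly
  \<open>(norm v)\<^sup>2\<close>, even for signed weights. The linear part measures how far the
  weighted mean of the features is from \<open>a\<close>.\<close>

lemma weighted_square_diff:
  fixes \<Phi> :: "'w::metric_space \<Rightarrow> 'h::real_inner" and s :: "'b \<Rightarrow> real"
  assumes s: "integrable N s" "(\<integral>\<omega>. s \<omega> \<partial>N) = 1" and \<zeta>[measurable]: "\<zeta> \<in> N \<rightarrow>\<^sub>M borel"
    and \<Phi>: "continuous_on UNIV \<Phi>" "\<And>y. norm (\<Phi> y) \<le> B"
  shows "(\<integral>\<omega>. s \<omega> * (norm (\<Phi> (\<zeta> \<omega>) - (a + v)))\<^sup>2 \<partial>N) - (\<integral>\<omega>. s \<omega> * (norm (\<Phi> (\<zeta> \<omega>) - a))\<^sup>2 \<partial>N)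
    = (norm v)\<^sup>2 - 2 * ((\<integral>\<omega>. s \<omega> * (\<Phi> (\<zeta> \<omega>) \<bullet> v) \<partial>N) - a \<bullet> v)"
proof -
  have i\<Phi>: "integrable N (\<lambda>\<omega>. s \<omega> * (\<Phi> (\<zeta> \<omega>) \<bullet> v))"
    using measurable_compose[OF \<zeta> borel_measurable_inner_feature(1)[OF \<Phi>(1), of v]]
    by (intro integrable_mult_bounded[OF s(1), where B = "B * norm v"])
      (auto intro!: order_trans[OF Cauchy_Schwarz_ineq2] mult_right_mono \<Phi>)
  have i2: "integrable N (\<lambda>\<omega>. s \<omega> * (norm (\<Phi> (\<zeta> \<omega>) - u))\<^sup>2)" for u
    using measurable_compose[OF \<zeta> borel_measurable_inner_feature(2)[OF \<Phi>(1), of u]]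
    by (intro integrable_mult_bounded[OF s(1), where B = "(B + norm u)\<^sup>2"])
      (auto intro!: power_mono order_trans[OF norm_triangle_ineq4] add_right_mono \<Phi>)
  have "s \<omega> * (norm (\<Phi> (\<zeta> \<omega>) - (a + v)))\<^sup>2 - s \<omega> * (norm (\<Phi> (\<zeta> \<omega>) - a))\<^sup>2
      = s \<omega> * ((norm v)\<^sup>2 + 2 * (a \<bullet> v)) - 2 * (s \<omega> * (\<Phi> (\<zeta> \<omega>) \<bullet> v))" for \<omega>
    by (simp add: power2_norm_eq_inner inner_diff_left inner_diff_right inner_add_left inner_add_right
        inner_commute algebra_simps)
  then have "(\<integral>\<omega>. s \<omega> * (norm (\<Phi> (\<zeta> \<omega>) - (a + v)))\<^sup>2 \<partial>N) - (\<integral>\<omega>. s \<omega> * (norm (\<Phi> (\<zeta> \<omega>) - a))\<^sup>2 \<partial>N)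
    = (\<integral>\<omega>. s \<omega> * ((norm v)\<^sup>2 + 2 * (a \<bullet> v)) - 2 * (s \<omega> * (\<Phi> (\<zeta> \<omega>) \<bullet> v)) \<partial>N)"
    by (subst Bochner_Integration.integral_diff[symmetric, OF i2 i2]) simp
  also have "\<dots> = (norm v)\<^sup>2 - 2 * ((\<integral>\<omega>. s \<omega> * (\<Phi> (\<zeta> \<omega>) \<bullet> v) \<partial>N) - a \<bullet> v)"
    using s i\<Phi> by (subst Bochner_Integration.integral_diff) auto
  finally show ?thesis .
qed

text \<open>If \<open>f z\<close> exceeded \<open>G\<close>, then by continuity \<open>f\<close>
  would be at least some \<open>c > G\<close> on an interval of length \<open>2 * d\<close>. The
  probability of that interval is a mixture of conditional probabilities, each at most
  \<open>G * (2 * d)\<close>.\<close>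

lemma marginal_density_le:
  fixes X :: "'a \<Rightarrow> real" and Y :: "'a \<Rightarrow> 'w::metric_space"
  assumes M: "prob_space M" and X[measurable]: "X \<in> borel_measurable M" and Y[measurable]: "Y \<in> M \<rightarrow>\<^sub>M borel"
    and FXY: "is_cond_distr M Y X FXY" "\<And>y. FXY y = density lborel (\<lambda>z. ennreal (g y z))"
    and g: "\<And>y z. g y z \<le> G" "\<And>y. g y \<in> borel_measurable borel"
    and f: "distributed M lborel X (\<lambda>z. ennreal (f z))" "continuous_on UNIV f" and G: "0 \<le> G"
  shows "f z \<le> G"
proof (rule ccontr)
  interpret prob_space M by fact
  assume "\<not> f z \<le> G"
  define c where "c = (f z + G) / 2"
  have c: "G < c" "c < f z" using \<open>\<not> f z \<le> G\<close> by (auto simp: c_def)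
  have "isCont f z" using f(2) by (simp add: continuous_on_eq_continuous_at)
  from order_tendstoD(1)[OF this[unfolded isCont_def] c(2)]
  obtain d where d: "0 < d" "\<And>u. u \<noteq> z \<Longrightarrow> dist u z < d \<Longrightarrow> c < f u"
    unfolding eventually_at by auto
  define A where "A = {z - d<..<z + d}"
  have A: "c \<le> f u" if "u \<in> A" for u
    using that d(2)[of u] c by (cases "u = z") (auto simp: A_def dist_real_def abs_less_iff)
  have lA: "(\<integral>\<^sup>+u. ennreal t * indicator A u \<partial>lborel) = ennreal (t * (2 * d))" if "0 \<le> t" for t
    using that d(1) by (subst nn_integral_cmult_indicator) (auto simp: A_def ennreal_mult)
  have [measurable]: "A \<in> sets borel" "f \<in> borel_measurable borel"
    using f(2) by (auto simp: A_def intro: borel_measurable_continuous_onI)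
  have "ennreal (c * (2 * d)) \<le> (\<integral>\<^sup>+u. ennreal (f u) * indicator A u \<partial>lborel)"
    using G c A by (subst lA[symmetric]) (auto simp: indicator_def intro!: nn_integral_mono ennreal_leI)
  also have "\<dots> = emeasure (distr M lborel X) A"
    using f(1) by (simp add: distributed_def emeasure_density)
  also have "\<dots> = emeasure M {\<omega> \<in> space M. Y \<omega> \<in> UNIV \<and> X \<omega> \<in> A}"
    by (subst emeasure_distr) (auto intro!: arg_cong[where f = "emeasure M"])
  also have "\<dots> = (\<integral>\<^sup>+y\<in>UNIV. emeasure (FXY y) A \<partial>distr M borel Y)"
    using FXY(1) unfolding is_cond_distr_def by fastforce
  also have "\<dots> \<le> (\<integral>\<^sup>+y. ennreal (G * (2 * d)) \<partial>distr M borel Y)"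
  proof (rule nn_integral_mono)
    fix y
    have [measurable]: "g y \<in> borel_measurable borel" by (rule g(2))
    have "emeasure (FXY y) A = (\<integral>\<^sup>+u. ennreal (g y u) * indicator A u \<partial>lborel)"
      unfolding FXY(2) by (simp add: emeasure_density)
    also have "\<dots> \<le> ennreal (G * (2 * d))"
      using g(1) G by (subst lA[symmetric]) (auto intro!: nn_integral_mono mult_right_mono ennreal_leI)
    finally show "emeasure (FXY y) A * indicator UNIV y \<le> ennreal (G * (2 * d))" by simp
  qed
  also have "\<dots> = ennreal (G * (2 * d))"
    using prob_space.emeasure_space_1[OF prob_space_distr[OF Y]] by simp
  finally have "c * (2 * d) \<le> G * (2 * d)" using G d(1) by (subst (asm) ennreal_le_iff) auto
  then show False using c d(1) by simp
qed

section \<open>Consistency\<close>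

theorem theorem2:
  fixes M :: "'a measure"
    and X :: "'a \<Rightarrow> real" and Y :: "'a \<Rightarrow> 'w::metric_space"
    and Xs :: "nat \<Rightarrow> 'a \<Rightarrow> real" and Ys :: "nat \<Rightarrow> 'a \<Rightarrow> 'w"
    and FYX :: "real \<Rightarrow> 'w measure" and FXY :: "'w \<Rightarrow> real measure"
    and f :: "real \<Rightarrow> real" and g :: "'w \<Rightarrow> real \<Rightarrow> real" and x :: real
    and k :: "'w \<Rightarrow> 'w \<Rightarrow> real"
    and fn_of :: "'h::{real_inner,complete_space} \<Rightarrow> 'w \<Rightarrow> real"
    and \<Phi> :: "'w \<Rightarrow> 'h" and \<epsilon> :: "'a \<Rightarrow> 'h" and \<sigma> :: "real \<Rightarrow> real"
    and K :: "real \<Rightarrow> real" and h :: "nat \<Rightarrow> real"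
  defines "\<Phi> \<equiv> feature k fn_of"
  assumes "prob_space M"
    and "X \<in> M \<rightarrow>\<^sub>M borel" and "Y \<in> M \<rightarrow>\<^sub>M borel"
    and "integrable M X" and "integrable M (\<lambda>\<omega>. (X \<omega>)\<^sup>2)"
    and "0 < (\<integral>\<omega>. (X \<omega> - (\<integral>\<omega>'. X \<omega>' \<partial>M))\<^sup>2 \<partial>M)"
    and FYX: "is_cond_distr M X Y FYX" and FXY: "is_cond_distr M Y X FXY"
    and iid: "prob_space.indep_vars M (\<lambda>_. borel \<Otimes>\<^sub>M borel) (\<lambda>i \<omega>. (Xs i \<omega>, Ys i \<omega>)) UNIV"
      "\<forall>i. distr M (borel \<Otimes>\<^sub>M borel) (\<lambda>\<omega>. (Xs i \<omega>, Ys i \<omega>)) =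
           distr M (borel \<Otimes>\<^sub>M borel) (\<lambda>\<omega>. (X \<omega>, Y \<omega>))"
    and f: "\<forall>z. 0 \<le> f z" "distributed M lborel X (\<lambda>z. ennreal (f z))"
      "\<not> bounded (closure {z. f z \<noteq> 0})" "0 < f x"
    and kernel: "pos_def_kernel k" "is_rkhs k fn_of" "integrable M (\<lambda>\<omega>. k (Y \<omega>) (Y \<omega>))"
    and model: "\<epsilon> \<in> M \<rightarrow>\<^sub>M borel"
      "prob_space.indep_set M {X -` A \<inter> space M |A. A \<in> sets borel}
         {\<epsilon> -` B \<inter> space M |B. B \<in> sets borel}"
      "\<forall>u. (\<integral>\<omega>. \<epsilon> \<omega> \<bullet> u \<partial>M) = 0" "(\<integral>\<omega>. (norm (\<epsilon> \<omega>))\<^sup>2 \<partial>M) = 1"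
      "\<forall>z. (\<sigma> z)\<^sup>2 = M_H FYX \<Phi> z (m_H FYX \<Phi> z)"
      "AE \<omega> in M. \<Phi> (Y \<omega>) = m_H FYX \<Phi> (X \<omega>) + \<sigma> (X \<omega>) *\<^sub>R \<epsilon> \<omega>"
    and standing: "m_H FYX \<Phi> x = \<Phi> (frechet_reg FYX x)"
    and K0: "K \<in> borel_measurable borel" "\<forall>u. 0 \<le> K u" "integrable lborel K"
      "(\<integral>u. K u \<partial>lborel) = 1" "\<forall>u. K (- u) = K u"
      "integrable lborel (\<lambda>u. K u * u ^ 4)"
      "integrable lborel (\<lambda>u. K u ^ 4 * u ^ 4)"
      "integrable lborel (\<lambda>u. K u ^ 2 * u ^ 6)"
    and L1: "twice_cont_diff f"
      "\<forall>y z. 0 \<le> g y z" "\<forall>y. FXY y = density lborel (\<lambda>z. ennreal (g y z))"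
      "\<forall>y. twice_cont_diff (g y)"
      "\<exists>B. \<forall>y z. \<bar>deriv (deriv (g y)) z\<bar> \<le> B"
      "\<forall>U. open U \<longrightarrow> continuous_on {z. 0 < f z} (\<lambda>z. measure (FYX z) U)"
    and S1: "compact (UNIV :: 'w set)"
    and S2: "\<exists>C>0. \<forall>w1 w2. norm (\<Phi> w1 - \<Phi> w2) \<le> C * dist w1 w2"
    and S3: "\<exists>B>0. \<forall>w. norm (\<Phi> w) < B"
    and S4: "\<exists>!w. is_arg_min (frechet_obj FYX x) (\<lambda>_. True) w"
      "\<forall>e>0. 0 < (INF u\<in>{u. norm (u - \<Phi> (frechet_reg FYX x)) > e}.
         ereal (M_H FYX \<Phi> x u - M_H FYX \<Phi> x (\<Phi> (frechet_reg FYX x))))"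
      "\<forall>e>0. 0 < liminf (\<lambda>n. INF u\<in>{u. norm (u - ltilde_H M X Y \<Phi> K x (h n)) > e}.
         ereal (Ltilde_H M X Y \<Phi> K x (h n) u
              - Ltilde_H M X Y \<Phi> K x (h n) (ltilde_H M X Y \<Phi> K x (h n))))"
    and S5: "\<forall>n. 0 < pop_sigma2 M X K x (h n) \<longrightarrow>
         (\<exists>!w. is_arg_min (Ltilde_k M X Y \<Phi> K x (h n)) (\<lambda>_. True) w)"
      "\<forall>n. AE \<omega> in M. 0 < emp_sigma2 K x (h n) n (\<lambda>i. Xs i \<omega>) \<longrightarrow>
         (\<exists>!w. is_arg_min (Lhat_k \<Phi> K x (h n) n (\<lambda>i. Xs i \<omega>) (\<lambda>i. Ys i \<omega>)) (\<lambda>_. True) w)"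
      "\<forall>e>0. 0 < liminf (\<lambda>n. INF w\<in>{w. dist w (ltilde_k M X Y \<Phi> K x (h n)) > e}.
         ereal (Ltilde_k M X Y \<Phi> K x (h n) w
              - Ltilde_k M X Y \<Phi> K x (h n) (ltilde_k M X Y \<Phi> K x (h n))))"
    and h: "\<forall>n. 0 < h n" "h \<longlonglongrightarrow> 0" "filterlim (\<lambda>n. real n * h n ^ 4) at_top sequentially"
  shows "is_oP1 M (\<lambda>n \<omega>. dist (frechet_reg FYX x)
           (lhat_k \<Phi> K x (h n) n (\<lambda>i. Xs i \<omega>) (\<lambda>i. Ys i \<omega>)))"
proof -
  interpret prob_space M by fact
  note X = \<open>X \<in> M \<rightarrow>\<^sub>M borel\<close> and Y = \<open>Y \<in> M \<rightarrow>\<^sub>M borel\<close>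

  \<comment> \<open>Regularity of the feature map, bounds on the densities, and the
    bandwidth\<close>
  define \<theta> where "\<theta> = \<Phi> (frechet_reg FYX x)"
  obtain C where "C > 0" and C: "norm (\<Phi> w1 - \<Phi> w2) \<le> C * dist w1 w2" for w1 w2 using S2 by auto
  obtain B where "B > 0" and "norm (\<Phi> w) < B" for w using S3 by auto
  then have B: "norm (\<Phi> w) \<le> B" for w by (simp add: less_imp_le)
  have \<Phi>: "continuous_on UNIV \<Phi>"
    using C \<open>C > 0\<close> by (intro lipschitz_on_continuous_on[of C] lipschitz_onI) (auto simp: dist_norm)
  obtain B2 where B2: "\<bar>deriv (deriv (g y)) z\<bar> \<le> B2" for y z using L1(5) by auto
  \<comment> \<open>The bound for a density whose second derivative is at most \<open>B2\<close> in
    absolute value; it holds for all \<open>g y\<close> and passes on to \<open>f\<close>.\<close>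
  define G where "G = 1 + B2 / 2"
  have g_cont: "continuous_on UNIV (g y)" for y
    using L1(4) by (auto simp: twice_cont_diff_def intro: differentiable_imp_continuous_on)
  have "0 \<le> B2" using order_trans[OF abs_ge_zero B2] .
  have g_le: "g y z \<le> G" for y z
    unfolding G_def
  proof (rule density_le_of_second_derivative_le[OF L1(4)[rule_format] L1(2)[rule_format] _ B2])
    show "prob_space (density lborel (\<lambda>z. ennreal (g y z)))"
      using prob_space_cond_distr(1)[OF FXY, of y] L1(3) by simp
  qed
  have f_cont: "continuous_on UNIV f"
    using L1(1) by (auto simp: twice_cont_diff_def intro: differentiable_imp_continuous_on)
  have f_le: "f z \<le> G" for z
  proof (rule marginal_density_le[OF \<open>prob_space M\<close> X Y FXY L1(3)[rule_format] g_le _ f(2) f_cont])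
    show "g y \<in> borel_measurable borel" for y by (rule borel_measurable_continuous_onI[OF g_cont])
    show "0 \<le> G" using \<open>0 \<le> B2\<close> by (simp add: G_def)
  qed
  have nh: "filterlim (\<lambda>n. real n * h n) at_top sequentially"
  proof (rule filterlim_at_top_mono[OF h(3)])
    have "\<forall>\<^sub>F n in sequentially. h n < 1" using h(2) by (rule order_tendstoD) simp
    then show "\<forall>\<^sub>F n in sequentially. real n * h n ^ 4 \<le> real n * h n"
    proof eventually_elim
      case (elim n)
      then have "h n ^ 4 \<le> h n" using h(1) power_decreasing[of 1 4 "h n"] by (simp add: less_imp_le)
      then show ?case by (rule mult_left_mono) simp
    qed
  qed
  interpret kernel_smoothing M X Y Xs Ys FYX f x G h
    using X Y FYX iid f(1,2,4) f_le f_cont L1(6) h nh by unfold_locales auto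

  \<comment> \<open>Moments of the kernel\<close>
  define \<kappa> where "\<kappa> j u = K u * u ^ j" for j u
  define \<mu> where "\<mu> j = (\<integral>u. \<kappa> j u \<partial>lborel)" for j
  have [measurable]: "K \<in> borel_measurable borel" by (rule K0(1))
  have \<kappa>_int: "integrable lborel (\<kappa> j)" if "j \<le> 2" for j
  proof (rule Bochner_Integration.integrable_bound)
    \<comment> \<open>Total mass and fourth moment dominate all moments up to order 2, by comparing
      \<open>\<bar>u\<bar>\<close> with 1.\<close>
    show "integrable lborel (\<lambda>u. K u + K u * u ^ 4)" using K0 by simp
    show "\<kappa> j \<in> borel_measurable lborel" unfolding \<kappa>_def by measurable
    have "\<bar>u\<bar> ^ j \<le> 1 + u ^ 4" for u :: real
    proof (cases "\<bar>u\<bar> \<le> 1")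
      case True
      then have "\<bar>u\<bar> ^ j \<le> 1" by (simp add: power_le_one)
      moreover have "0 \<le> u ^ 4" by simp
      ultimately show ?thesis by linarith
    next
      case False
      then have "\<bar>u\<bar> ^ j \<le> \<bar>u\<bar> ^ 4" using that by (intro power_increasing) auto
      then show ?thesis by simp
    qed
    then have "K u * \<bar>u\<bar> ^ j \<le> K u * (1 + u ^ 4)" for u using K0(2) by (intro mult_left_mono) auto
    then show "AE u in lborel. norm (\<kappa> j u) \<le> norm (K u + K u * u ^ 4)"
      using K0(2) by (auto simp: \<kappa>_def abs_mult power_abs distrib_left)
  qed
  have \<mu>0: "\<mu> 0 = 1" using K0(4) by (simp add: \<mu>_def \<kappa>_def)
  \<comment> \<open>Reflection at 0, with the symmetry of \<open>K\<close>.\<close>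
  have "\<mu> 1 = - \<mu> 1"
  proof -
    have "\<mu> 1 = (\<integral>u. \<kappa> 1 (0 + (- 1) * u) \<partial>lborel)"
      unfolding \<mu>_def by (subst lborel_integral_real_affine[of "- 1" _ 0]) simp_all
    also have "\<dots> = (\<integral>u. - \<kappa> 1 u \<partial>lborel)" using K0(5) by (simp add: \<kappa>_def)
    finally show ?thesis by (simp add: \<mu>_def)
  qed
  then have \<mu>1: "\<mu> 1 = 0" by simp
  \<comment> \<open>A vanishing second moment would make \<open>K\<close> zero almost everywhere off
    the null set \<open>{0}\<close>, against its total mass 1.\<close>
  have \<mu>2: "0 < \<mu> 2"
  proof (rule ccontr)
    assume "\<not> 0 < \<mu> 2"
    moreover have nn: "0 \<le> \<kappa> 2 u" for u using K0(2) by (simp add: \<kappa>_def)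
    then have "0 \<le> \<mu> 2" unfolding \<mu>_def by simp
    ultimately have "\<mu> 2 = 0" by simp
    then have "AE u in lborel. \<kappa> 2 u = 0"
      unfolding \<mu>_def using integral_nonneg_eq_0_iff_AE[OF \<kappa>_int[of 2]] nn by simp
    moreover have "AE u in lborel. u \<noteq> (0 :: real)" by (rule AE_lborel_singleton)
    ultimately have "AE u in lborel. K u = 0" by eventually_elim (simp add: \<kappa>_def)
    then have "(\<integral>u. K u \<partial>lborel) = 0" by (subst integral_cong_AE[where g = "\<lambda>_. 0"]) auto
    then show False using K0(4) by simp
  qed
  have prodx: "K ((z - x) / h n) * ((z - x) / h n) ^ j / h n = \<kappa> j ((z - x) / h n) / h n" for z n j
    by (simp add: \<kappa>_def)
  have abs_int: "integrable lborel (\<lambda>u. \<bar>\<kappa> 1 u\<bar>)" using \<kappa>_int[of 1] by simp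
  have abs_h: "\<bar>\<kappa> 1 u / h n\<bar> = \<bar>\<kappa> 1 u\<bar> / h n" for u n using h_pos[of n] by simp

  \<comment> \<open>The mean of the features under the conditional distribution\<close>
  define P where "P = FYX x"
  have P: "prob_space P" "sets P = sets borel"
    using prob_space_cond_distr[OF FYX, of x] by (auto simp: P_def)
  have id_P: "(\<lambda>y. y) \<in> P \<rightarrow>\<^sub>M borel" using P(2) by (simp add: measurable_ident_sets)
  \<comment> \<open>The population objective is quadratic with constant weight 1, and by
    \<open>S4(2)\<close> it is larger than at \<open>\<theta>\<close> outside every ball. Hence its
    linear part at \<open>\<theta>\<close> is at most \<open>e * norm v\<close> for every
    \<open>e > 0\<close>, that is, zero.\<close>
  have \<theta>: "(\<integral>y. \<Phi> y \<bullet> v \<partial>P) = \<theta> \<bullet> v" for v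
  proof -
    interpret P: prob_space P by (rule P(1))
    have one: "integrable P (\<lambda>_. 1 :: real)" by simp
    let ?r = "\<lambda>v. (\<integral>y. \<Phi> y \<bullet> v \<partial>P) - \<theta> \<bullet> v"
    have "\<bar>?r v\<bar> \<le> e * norm v" if "0 < e" for e
    proof (rule linear_part_le[OF that])
      show "?r (c *\<^sub>R v) = c * ?r v" for c v by (simp add: algebra_simps)
      fix v :: 'h assume "e < norm v"
      then have "(\<theta> + v) \<in> {u. norm (u - \<theta>) > e}" by simp
      from less_INF_D[OF S4(2)[rule_format, OF that, folded \<theta>_def] this]
      have "M_H FYX \<Phi> x \<theta> < M_H FYX \<Phi> x (\<theta> + v)" by simp
      then show "0 \<le> (norm v)\<^sup>2 - 2 * ?r v"
        using weighted_square_diff[OF one _ id_P \<Phi> B, of \<theta> v] P.prob_space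
        by (simp add: M_H_def P_def)
    qed
    then have "\<bar>?r v\<bar> \<le> 0 + e" if "0 < e" for e
    proof -
      \<comment> \<open>The summand 1 keeps the denominator positive for
        \<open>v = 0\<close>.\<close>
      have "\<bar>?r v\<bar> \<le> e / (norm v + 1) * norm v"
        using \<open>\<And>e. 0 < e \<Longrightarrow> \<bar>?r v\<bar> \<le> e * norm v\<close>[of "e / (norm v + 1)"] that by (simp add: add_nonneg_pos)
      also have "\<dots> \<le> e" using that by (simp add: divide_simps add_nonneg_pos mult_left_mono)
      finally show ?thesis by simp
    qed
    then have "\<bar>?r v\<bar> \<le> 0" by (rule field_le_epsilon)
    then show ?thesis by simp
  qed

  \<comment> \<open>Population weights and the limit of \<open>ltilde_H\<close>\<close>
  have pop_lim: "(\<lambda>n. \<integral>\<omega>. indicator U (Y \<omega>) * (\<kappa> j ((X \<omega> - x) / h n) / h n) \<partial>M) \<longlonglongrightarrow> f x * measure P U * \<mu> j"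
    if "open U" "j \<le> 2" for U j
    unfolding P_def \<mu>_def by (rule population_limit[OF \<kappa>_int[OF that(2)] that(1)])
  have abs_lim: "(\<lambda>n. \<integral>\<omega>. \<bar>\<kappa> 1 ((X \<omega> - x) / h n) / h n\<bar> \<partial>M)
      \<longlonglongrightarrow> f x * measure P UNIV * (\<integral>u. \<bar>\<kappa> 1 u\<bar> \<partial>lborel)"
    using population_limit[OF abs_int open_UNIV] unfolding P_def abs_h indicator_UNIV mult_1 .
  have pop: "\<forall>\<^sub>F n in sequentially. 0 < scaled_sigma2 M X K x (h n)"
    "\<forall>\<^sub>F n in sequentially. \<forall>v. \<bar>(\<integral>\<omega>. pop_s M X K x (h n) (X \<omega>) * (\<Phi> (Y \<omega>) \<bullet> v) \<partial>M) - \<theta> \<bullet> v\<bar> \<le> e * norm v"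
    if "0 < e" for e
  proof -
    note limits = local_linear_limit[where N = "\<lambda>_. M" and \<xi> = "\<lambda>_. X" and \<zeta> = "\<lambda>_. Y" and h = h and K = K and x = x
        and F = sequentially and \<mu> = \<mu> and c = "f x" and P = P and \<Phi> = \<Phi> and \<theta> = \<theta> and e = e,
        unfolded prodx, OF h_pos K0(2)[rule_format] Y kernel_integrable_X[OF \<kappa>_int] pop_lim abs_lim
          \<mu>0 \<mu>1 \<mu>2 f_pos \<Phi> B S1 P \<theta> that]
    show "\<forall>\<^sub>F n in sequentially. 0 < scaled_sigma2 M X K x (h n)" by (rule limits(1))
    show "\<forall>\<^sub>F n in sequentially. \<forall>v. \<bar>(\<integral>\<omega>. pop_s M X K x (h n) (X \<omega>) * (\<Phi> (Y \<omega>) \<bullet> v) \<partial>M) - \<theta> \<bullet> v\<bar> \<le> e * norm v"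
      by (rule limits(2))
  qed

  have \<theta>_lim: "(\<lambda>n. ltilde_H M X Y \<Phi> K x (h n)) \<longlonglongrightarrow> \<theta>"
    unfolding tendsto_iff dist_norm
  proof (intro allI impI)
    fix d :: real assume "0 < d"
    \<comment> \<open>One \<open>e\<close> bounds the linear part at \<open>ltilde_H\<close>, a
      second one the distance of the weighted means from \<open>\<theta>\<close>; together they give
      \<open>2 * e < d\<close>.\<close>
    define e where "e = d / 3"
    have e: "0 < e" using \<open>0 < d\<close> by (simp add: e_def)
    have "\<forall>\<^sub>F n in sequentially. 0 < (INF u\<in>{u. norm (u - ltilde_H M X Y \<Phi> K x (h n)) > e}.
         ereal (Ltilde_H M X Y \<Phi> K x (h n) u - Ltilde_H M X Y \<Phi> K x (h n) (ltilde_H M X Y \<Phi> K x (h n))))"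
      using S4(3)[rule_format, OF e] by (rule less_LiminfD)
    then show "\<forall>\<^sub>F n in sequentially. norm (ltilde_H M X Y \<Phi> K x (h n) - \<theta>) < d"
      using pop[OF e]
    proof eventually_elim
      case (elim n)
      let ?a = "ltilde_H M X Y \<Phi> K x (h n)"
      let ?l = "\<lambda>v. \<integral>\<omega>. pop_s M X K x (h n) (X \<omega>) * (\<Phi> (Y \<omega>) \<bullet> v) \<partial>M"
      have int: "integrable M (\<lambda>\<omega>. K ((X \<omega> - x) / h n) * ((X \<omega> - x) / h n) ^ j / h n)" if "j \<le> 2" for j
        unfolding prodx by (rule kernel_integrable_X[OF \<kappa>_int[OF that]])
      have s: "integrable M (\<lambda>\<omega>. pop_s M X K x (h n) (X \<omega>))" "(\<integral>\<omega>. pop_s M X K x (h n) (X \<omega>) \<partial>M) = 1"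
        using integrable_pop_s[OF h_pos int] integral_pop_s[OF h_pos int] elim(2) by auto
      have lin: "\<bar>?l v - ?a \<bullet> v\<bar> \<le> e * norm v" for v
      proof (rule linear_part_le[OF e])
        show "?l (c *\<^sub>R v) - ?a \<bullet> (c *\<^sub>R v) = c * (?l v - ?a \<bullet> v)" for c v
          by (simp add: algebra_simps)
        fix v :: 'h assume "e < norm v"
        then have "(?a + v) \<in> {u. norm (u - ?a) > e}" by simp
        from less_INF_D[OF elim(1) this]
        have "Ltilde_H M X Y \<Phi> K x (h n) ?a < Ltilde_H M X Y \<Phi> K x (h n) (?a + v)" by simp
        then show "0 \<le> (norm v)\<^sup>2 - 2 * (?l v - ?a \<bullet> v)"
          using weighted_square_diff[OF s Y \<Phi> B, of ?a v] by (simp add: Ltilde_H_def)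
      qed
      have "\<bar>(?a - \<theta>) \<bullet> v\<bar> \<le> (2 * e) * norm v" for v
        using lin[of v] elim(3)[rule_format, of v] unfolding inner_diff_left by linarith
      then have "norm (?a - \<theta>) \<le> 2 * e" by (rule norm_le_of_inner_le) (use e in simp)
      then show ?case using e by (simp add: e_def)
    qed
  qed

  \<comment> \<open>From closeness in feature space to closeness in the metric space\<close>
  have identified: "\<exists>\<eta>>0. \<forall>w. norm (\<Phi> w - \<theta>) < \<eta> \<longrightarrow> dist (frechet_reg FYX x) w \<le> 2 * e" if e: "0 < e" for e
  proof -
    obtain c where c: "0 < ereal c" "ereal c < liminf (\<lambda>n. INF w\<in>{w. dist w (ltilde_k M X Y \<Phi> K x (h n)) > e}.
         ereal (Ltilde_k M X Y \<Phi> K x (h n) w - Ltilde_k M X Y \<Phi> K x (h n) (ltilde_k M X Y \<Phi> K x (h n))))"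
      using ereal_dense2[OF S5(3)[rule_format, OF e]] by auto
    \<comment> \<open>Chosen so that two distances below \<open>\<eta>\<close>, from
      \<open>ltilde_H\<close> to \<open>\<theta>\<close> and from \<open>\<theta>\<close> to
      \<open>\<Phi> w\<close>, keep the objective at \<open>w\<close> at most
      \<open>c\<close>.\<close>
    define \<eta> where "\<eta> = sqrt c / 2"
    have \<eta>: "0 < \<eta>" "(2 * \<eta>)\<^sup>2 = c" using c(1) by (auto simp: \<eta>_def)
    have "\<forall>\<^sub>F n in sequentially. norm (ltilde_H M X Y \<Phi> K x (h n) - \<theta>) < \<eta>"
      using \<theta>_lim \<eta>(1) unfolding tendsto_iff dist_norm by simp
    then have "\<forall>\<^sub>F n in sequentially. norm (ltilde_H M X Y \<Phi> K x (h n) - \<theta>) < \<eta> \<and>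
       ereal c < (INF w\<in>{w. dist w (ltilde_k M X Y \<Phi> K x (h n)) > e}.
         ereal (Ltilde_k M X Y \<Phi> K x (h n) w - Ltilde_k M X Y \<Phi> K x (h n) (ltilde_k M X Y \<Phi> K x (h n))))"
      using less_LiminfD[OF c(2)] by (rule eventually_conj)
    \<comment> \<open>A single \<open>n\<close> suffices, since neither \<open>\<theta>\<close> nor
      the claim about \<open>w\<close> depends on it.\<close>
    then obtain n where n: "norm (ltilde_H M X Y \<Phi> K x (h n) - \<theta>) < \<eta>"
       "ereal c < (INF w\<in>{w. dist w (ltilde_k M X Y \<Phi> K x (h n)) > e}.
         ereal (Ltilde_k M X Y \<Phi> K x (h n) w - Ltilde_k M X Y \<Phi> K x (h n) (ltilde_k M X Y \<Phi> K x (h n))))"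
      using eventually_happens by force
    let ?w = "ltilde_k M X Y \<Phi> K x (h n)"
    have near: "dist w ?w \<le> e" if "norm (\<Phi> w - \<theta>) < \<eta>" for w
    proof (rule ccontr)
      assume "\<not> dist w ?w \<le> e"
      then have "c < Ltilde_k M X Y \<Phi> K x (h n) w - Ltilde_k M X Y \<Phi> K x (h n) ?w"
        using less_INF_D[OF n(2), of w] by simp
      also have "\<dots> \<le> (norm (ltilde_H M X Y \<Phi> K x (h n) - \<Phi> w))\<^sup>2" by (simp add: Ltilde_k_def)
      also have "norm (ltilde_H M X Y \<Phi> K x (h n) - \<Phi> w) \<le> norm (ltilde_H M X Y \<Phi> K x (h n) - \<theta>) + norm (\<Phi> w - \<theta>)"
        using norm_triangle_ineq4[of "ltilde_H M X Y \<Phi> K x (h n) - \<theta>" "\<Phi> w - \<theta>"] by simp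
      then have "(norm (ltilde_H M X Y \<Phi> K x (h n) - \<Phi> w))\<^sup>2 \<le> (2 * \<eta>)\<^sup>2"
        using n(1) that by (intro power_mono) auto
      finally show False using \<eta>(2) by simp
    qed
    \<comment> \<open>Both \<open>w\<close> and the regression value are within \<open>e\<close> of
      \<open>?w\<close>, the latter because its feature is \<open>\<theta>\<close> itself.\<close>
    have "dist (frechet_reg FYX x) w \<le> 2 * e" if "norm (\<Phi> w - \<theta>) < \<eta>" for w
      using near[OF that] near[of "frechet_reg FYX x"] \<eta>(1) dist_triangle2[of "frechet_reg FYX x" w ?w]
      by (simp add: \<theta>_def)
    then show ?thesis using \<eta>(1) by blast
  qed

  \<comment> \<open>Sample weights and the limit of \<open>lhat_H\<close>\<close>
  let ?N = "\<lambda>(n, \<omega>). uniform_count_measure {..<n}"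
  \<comment> \<open>The uniform measure on the indices turns sample averages into integrals, so the
    limit lemma applies with one measure for each pair \<open>z\<close>. The sample point enters
    only through the observed values.\<close>
  have emp: "\<forall>\<^sub>F z in prob_filter M. \<forall>v. \<bar>(\<integral>i. pop_s (?N z) (\<lambda>i. Xs i (snd z)) K x (h (fst z)) (Xs i (snd z))
      * (\<Phi> (Ys i (snd z)) \<bullet> v) \<partial>?N z) - \<theta> \<bullet> v\<bar> \<le> e * norm v" if "0 < e" for e
  proof (rule local_linear_limit(2)[where N = ?N and \<xi> = "\<lambda>z i. Xs i (snd z)" and \<zeta> = "\<lambda>z i. Ys i (snd z)"
        and h = "\<lambda>z. h (fst z)" and K = K and x = x and \<mu> = \<mu> and c = "f x" and P = P and \<Phi> = \<Phi> and \<theta> = \<theta> and e = e,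
        unfolded prodx, OF h_pos K0(2)[rule_format] _ _ _ _ \<mu>0 \<mu>1 \<mu>2 f_pos \<Phi> B S1 P \<theta> that])
    show "(\<lambda>i. Ys i (snd z)) \<in> ?N z \<rightarrow>\<^sub>M borel" for z
      by (cases z) (auto simp: measurable_def sets_uniform_count_measure space_uniform_count_measure)
    show "integrable (?N z) (\<lambda>i. \<kappa> j ((Xs i (snd z) - x) / h (fst z)) / h (fst z))" for z j
      by (cases z) (auto simp: uniform_count_measure_def intro: integrable_point_measure_finite)
    show "((\<lambda>z. \<integral>i. indicator U (Ys i (snd z)) * (\<kappa> j ((Xs i (snd z) - x) / h (fst z)) / h (fst z)) \<partial>?N z)
        \<longlongrightarrow> f x * measure P U * \<mu> j) (prob_filter M)" if "open U" "j \<le> 2" for U j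
      using sample_limit[OF \<kappa>_int[OF that(2)] that(1)] unfolding P_def \<mu>_def
      by (simp only: case_prod_unfold integral_uniform_count_measure[OF finite_lessThan] card_lessThan
          indicator_UNIV mult_1)
    show "((\<lambda>z. \<integral>i. \<bar>\<kappa> 1 ((Xs i (snd z) - x) / h (fst z)) / h (fst z)\<bar> \<partial>?N z)
        \<longlongrightarrow> f x * measure P UNIV * (\<integral>u. \<bar>\<kappa> 1 u\<bar> \<partial>lborel)) (prob_filter M)"
      using sample_limit[OF abs_int open_UNIV] unfolding P_def abs_h
      by (simp only: case_prod_unfold integral_uniform_count_measure[OF finite_lessThan] card_lessThan
          indicator_UNIV mult_1)
  qed
  \<comment> \<open>Over the uniform measure \<open>pop_mu\<close> is \<open>emp_mu\<close>, so the
    two kinds of weights agree and the integral is the average defining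
    \<open>lhat_H\<close>.\<close>
  have lhat_inner: "(\<integral>i. pop_s (?N (n, \<omega>)) (\<lambda>i. Xs i \<omega>) K x (h n) (Xs i \<omega>) * (\<Phi> (Ys i \<omega>) \<bullet> v) \<partial>?N (n, \<omega>))
      = lhat_H \<Phi> K x (h n) n (\<lambda>i. Xs i \<omega>) (\<lambda>i. Ys i \<omega>) \<bullet> v" for n \<omega> v
  proof -
    have "pop_mu (uniform_count_measure {..<n}) (\<lambda>i. Xs i \<omega>) K x (h n) = emp_mu K x (h n) n (\<lambda>i. Xs i \<omega>)"
      by (simp add: fun_eq_iff pop_mu_def emp_mu_def integral_uniform_count_measure)
    then have "pop_s (uniform_count_measure {..<n}) (\<lambda>i. Xs i \<omega>) K x (h n) (Xs i \<omega>) = emp_s K x (h n) n (\<lambda>i. Xs i \<omega>) i" for i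
      by (simp add: pop_s_def emp_s_def pop_sigma2_def emp_sigma2_def)
    then show ?thesis
      by (simp add: lhat_H_def integral_uniform_count_measure inner_sum_left)
  qed
  have lhat: "\<forall>\<^sub>F (n, \<omega>) in prob_filter M. norm (lhat_H \<Phi> K x (h n) n (\<lambda>i. Xs i \<omega>) (\<lambda>i. Ys i \<omega>) - \<theta>) \<le> e"
    if "0 < e" for e
    using emp[OF that]
  proof eventually_elim
    case (elim z)
    obtain n \<omega> where z: "z = (n, \<omega>)" by (cases z)
    have "norm (lhat_H \<Phi> K x (h n) n (\<lambda>i. Xs i \<omega>) (\<lambda>i. Ys i \<omega>) - \<theta>) \<le> e"
      using elim that lhat_inner[of n \<omega>] by (intro norm_le_of_inner_le) (auto simp: z inner_diff_left)
    then show ?case by (simp add: z)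
  qed

  \<comment> \<open>From \<open>lhat_H\<close> to the estimator \<open>lhat_k\<close>\<close>
  have lhat_k_le: "norm (\<Phi> (lhat_k \<Phi> K x t n xs ys) - \<theta>) \<le> 2 * norm (lhat_H \<Phi> K x t n xs ys - \<theta>)" for t n xs ys
  proof -
    let ?l = "lhat_H \<Phi> K x t n xs ys" and ?L = "Lhat_k \<Phi> K x t n xs ys"
    \<comment> \<open>By compactness a minimiser exists for every realised sample, so
      \<open>arg_min\<close> returns a true minimiser and the bound holds without an exceptional
      set. The competitor \<open>frechet_reg FYX x\<close> has the feature \<open>\<theta>\<close>;
      the triangle inequality gives the factor 2.\<close>
    have "continuous_on UNIV ?L" unfolding Lhat_k_def by (intro continuous_intros \<Phi>)
    from continuous_attains_inf[OF S1 _ this] obtain w where "\<And>w'. ?L w \<le> ?L w'" by auto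
    then have "is_arg_min ?L (\<lambda>_. True) w" by (simp add: is_arg_min_linorder)
    then have "is_arg_min ?L (\<lambda>_. True) (lhat_k \<Phi> K x t n xs ys)"
      unfolding lhat_k_def arg_min_def by (rule someI)
    then have "?L (lhat_k \<Phi> K x t n xs ys) \<le> ?L (frechet_reg FYX x)" by (simp add: is_arg_min_linorder)
    then have "norm (?l - \<Phi> (lhat_k \<Phi> K x t n xs ys)) \<le> norm (?l - \<theta>)"
      unfolding Lhat_k_def \<theta>_def by (rule power2_le_imp_le) simp
    then show ?thesis
      using norm_triangle_ineq4[of "?l - \<theta>" "?l - \<Phi> (lhat_k \<Phi> K x t n xs ys)"] by simp
  qed

  show ?thesis
    unfolding is_oP1_iff tendsto_iff
  proof (intro allI impI)
    fix e :: real assume "0 < e"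
    \<comment> \<open>The choices \<open>e / 3\<close> here and \<open>\<eta> / 3\<close> below
      leave room for the factors 2 in \<open>identified\<close> and \<open>lhat_k_le\<close> and
      make the resulting inequalities strict.\<close>
    then obtain \<eta> where "0 < \<eta>" and \<eta>: "\<And>w. norm (\<Phi> w - \<theta>) < \<eta> \<Longrightarrow> dist (frechet_reg FYX x) w \<le> 2 * (e / 3)"
      using identified[of "e / 3"] by auto
    have "\<forall>\<^sub>F (n, \<omega>) in prob_filter M. norm (lhat_H \<Phi> K x (h n) n (\<lambda>i. Xs i \<omega>) (\<lambda>i. Ys i \<omega>) - \<theta>) \<le> \<eta> / 3"
      by (rule lhat) (use \<open>0 < \<eta>\<close> in simp)
    then show "\<forall>\<^sub>F z in prob_filter M. dist (case z of (n, \<omega>) \<Rightarrow> dist (frechet_reg FYX x)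
        (lhat_k \<Phi> K x (h n) n (\<lambda>i. Xs i \<omega>) (\<lambda>i. Ys i \<omega>))) 0 < e"
    proof eventually_elim
      case (elim z)
      obtain n \<omega> where z: "z = (n, \<omega>)" by (cases z)
      have "norm (\<Phi> (lhat_k \<Phi> K x (h n) n (\<lambda>i. Xs i \<omega>) (\<lambda>i. Ys i \<omega>)) - \<theta>) < \<eta>"
        using elim \<open>0 < \<eta>\<close> lhat_k_le[of "h n" n "\<lambda>i. Xs i \<omega>" "\<lambda>i. Ys i \<omega>"] by (simp add: z)
      from \<eta>[OF this] show ?case using \<open>0 < e\<close> by (simp add: z)
    qed
  qed
qed

end
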